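(* Let $S_1,S_2,T_1,T_2,P_1$ and $P_2$ be Cu-semigroups. Given $x_k\in[\![S_k,T_k]\!]$ and $y_k\in[\![T_k,P_k]\!]$ for $k=1,2$, we have $$(y_2\boxtimes y_1)\circ(x_2\boxtimes x_1)=(y_2\circ x_2)\boxtimes(y_1\circ x_1).$$
   Context: A positively ordered semigroup is a commutative monoid $(S,+,0)$ with a partial order $\le$ compatible with addition such that $0\le a$ for all $a$. For $a,b\in S$, $a\ll b$ (way-below) means: whenever $(c_n)_n$ is an increasing sequence in $S$ whose supremum exists and satisfies $b\le\sup_n c_n$, there is $k$ with $a\le c_k$. A Cu-semigroup is a positively ordered semigroup satisfying: (O1) every increasing sequence has a supremum; (O2) every $a$ is the supremum of a sequence $(a_n)_n$ with $a_n\ll a_{n+1}$ for all $n$; (O3) $a'\ll a$ and $b'\ll b$ imply $a'+b'\ll a+b$; (O4) $\sup_n(a_n+b_n)=\sup_n a_n+\sup_n b_n$ for increasing sequences. A generalized Cu-morphism is a map between Cu-semigroups preserving addition, zero, order and suprema of increasing sequences; a Cu-morphism additionally preserves $\ll$. $\mathrm{Cu}[S,T]$ and $\mathrm{Cu}(S,T)$ denote the sets of generalized Cu-morphisms and of Cu-morphisms $S\to T$, with pointwise order and addition. A Cu-bimorphism $\varphi\colon S\times T\to P$ is a map that is additive, zero- and order-preserving in each variable, satisfies $\sup_k\varphi(a_k,b_k)=\varphi(\sup_k a_k,\sup_k b_k)$ for increasing sequences, and satisfies $\varphi(a',b')\ll\varphi(a,b)$ whenever $a'\ll a$ and $b'\ll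 b$. $S\otimes T$ denotes the Cu-semigroup with universal Cu-bimorphism $S\times T\to S\otimes T$, $(a,b)\mapsto a\otimes b$: every Cu-bimorphism $S\times T\to P$ factors through a unique Cu-morphism $S\otimes T\to P$, and Cu-morphisms $\alpha_1,\alpha_2\colon S\otimes T\to P$ satisfy $\alpha_1\le\alpha_2$ iff $\alpha_1(a\otimes b)\le\alpha_2(a\otimes b)$ for all $a,b$. The tensor product is associative and symmetric up to natural isomorphism. For (generalized) Cu-morphisms $\varphi_k\colon S_k\to T_k$, $k=1,2$, $\varphi_1\otimes\varphi_2\colon S_1\otimes S_2\to T_1\otimes T_2$ is the unique (generalized) Cu-morphism with $(\varphi_1\otimes\varphi_2)(a\otimes b)=\varphi_1(a)\otimes\varphi_2(b)$. Let $I_{\mathbb Q}=\mathbb Q\cap(0,1)$. For $\varphi,\psi\in\mathrm{Cu}[S,T]$ write $\varphi\prec\psi$ if $\varphi(a')\ll\psi(a)$ whenever $a'\ll a$ in $S$. A path in $\mathrm{Cu}[S,T]$ is a family $\mathbf f=(f_\lambda)_{\lambda\in I_{\mathbb Q}}$ with $f_{\lambda'}\prec f_\lambda$ whenever $\lambda'<\lambda$. Write $\mathbf f\lesssim\mathbf g$ if for every $\lambda$ there is $\mu$ with $f_\lambda\prec g_\mu$. The internal hom $[\![S,T]\!]$ is the set of classes $[\mathbf f]$ of paths modulo ($\mathbf f\lesssim\mathbf g$ and $\mathbf g\lesssim\mathbf f$), with $[\mathbf f]+[\mathbf g]=[(f_\lambda+g_\lambda)_\lambda]$ and $[\mathbf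 f]\le[\mathbf g]$ iff $\mathbf f\lesssim\mathbf g$; it is a Cu-semigroup. The endpoint map $\sigma_{S,T}\colon[\![S,T]\!]\to\mathrm{Cu}[S,T]$ is $\sigma_{S,T}([\mathbf f])(a)=\sup_\lambda f_\lambda(a)$. It is known that for Cu-semigroups $S,T,P$ there is a bijection $\mathrm{Cu}(S,[\![T,P]\!])\cong\mathrm{Cu}(S\otimes T,P)$ sending $\alpha$ to the Cu-morphism $a\otimes b\mapsto\sigma_{T,P}(\alpha(a))(b)$. The evaluation map $\mathrm e_{S,T}\colon[\![S,T]\!]\otimes S\to T$ is the Cu-morphism corresponding to $\mathrm{id}_{[\![S,T]\!]}$. The composition product $\circ\colon[\![T,P]\!]\otimes[\![S,T]\!]\to[\![S,P]\!]$, $y\otimes x\mapsto y\circ x$, is the Cu-morphism corresponding to $\mathrm e_{T,P}\circ(\mathrm{id}_{[\![T,P]\!]}\otimes\mathrm e_{S,T})\colon[\![T,P]\!]\otimes[\![S,T]\!]\otimes S\to P$. The external tensor product $\boxtimes\colon[\![S_1,T_1]\!]\otimes[\![S_2,T_2]\!]\to[\![S_1\otimes S_2,T_1\otimes T_2]\!]$, $x_1\otimes x_2\mapsto x_1\boxtimes x_2$, is (for arbitrary Cu-semigroups $S_1,S_2,T_1,T_2$) the Cu-morphism corresponding, under the bijection $\mathrm{Cu}([\![S_1,T_1]\!]\otimes[\![S_2,T_2]\!],[\![S_1\otimes S_2,T_1\otimes T_2]\!])\cong\mathrm{Cu}([\![S_1,T_1]\!]\otimes[\![S_2,T_2]\!]\otimes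 S_1\otimes S_2,T_1\otimes T_2)$ sending $\alpha$ to the Cu-morphism $u\otimes v\mapsto\sigma_{S_1\otimes S_2,T_1\otimes T_2}(\alpha(u))(v)$, to the Cu-morphism $(\mathrm e_{S_1,T_1}\otimes\mathrm e_{S_2,T_2})\circ(\mathrm{id}_{[\![S_1,T_1]\!]}\otimes\sigma\otimes\mathrm{id}_{S_2})\colon[\![S_1,T_1]\!]\otimes[\![S_2,T_2]\!]\otimes S_1\otimes S_2\to T_1\otimes T_2$, where $\sigma\colon[\![S_2,T_2]\!]\otimes S_1\to S_1\otimes[\![S_2,T_2]\!]$ is the flip isomorphism. *)

theory Defs
  imports Complex_Main "HOL-Library.Multiset" "HOL-Library.Nat_Bijection" "HOL-Library.Countable_Set"
begin


subsection \<open>Cu-semigroups\<close>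

context order
begin

definition is_lub :: "'a set \<Rightarrow> 'a \<Rightarrow> bool"
  where "is_lub A s \<longleftrightarrow> (\<forall>a\<in>A. a \<le> s) \<and> (\<forall>u. (\<forall>a\<in>A. a \<le> u) \<longrightarrow> s \<le> u)"

definition lub :: "'a set \<Rightarrow> 'a"
  where "lub A = (THE s. is_lub A s)"

definition increasing :: "(nat \<Rightarrow> 'a) \<Rightarrow> bool"
  where "increasing c \<longleftrightarrow> (\<forall>n. c n \<le> c (Suc n))"

definition way_below :: "'a \<Rightarrow> 'a \<Rightarrow> bool"  (infix "\<lless>" 50)
  where "a \<lless> b \<longleftrightarrow>
    (\<forall>c s. increasing c \<and> is_lub (range c) s \<and> b \<le> s \<longrightarrow> (\<exists>k. a \<le> c k))"

end

class positively_ordered_semigroup = ordered_comm_monoid_add +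
  assumes zero_least: "0 \<le> a"

class cu_semigroup = positively_ordered_semigroup +
  assumes O1: "increasing c \<Longrightarrow> \<exists>s. is_lub (range c) s"
    and O2: "\<exists>c. (\<forall>n. c n \<lless> c (Suc n)) \<and> is_lub (range c) a"
    and O3: "a' \<lless> a \<Longrightarrow> b' \<lless> b \<Longrightarrow> a' + b' \<lless> a + b"
    and O4: "increasing c \<Longrightarrow> increasing d \<Longrightarrow>
      lub (range (\<lambda>n. c n + d n)) = lub (range c) + lub (range d)"

definition gen_cu_morphism :: "('a::cu_semigroup \<Rightarrow> 'b::cu_semigroup) \<Rightarrow> bool"
  where "gen_cu_morphism f \<longleftrightarrow>
    (\<forall>a b. f (a + b) = f a + f b) \<and> f 0 = 0 \<and> mono f \<and>
    (\<forall>c. increasing c \<longrightarrow> f (lub (range c)) = lub (range (\<lambda>n. f (c n))))"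

definition cu_morphism :: "('a::cu_semigroup \<Rightarrow> 'b::cu_semigroup) \<Rightarrow> bool"
  where "cu_morphism f \<longleftrightarrow> gen_cu_morphism f \<and> (\<forall>a' a. a' \<lless> a \<longrightarrow> f a' \<lless> f a)"

definition cu_bimorphism ::
    "('a::cu_semigroup \<Rightarrow> 'b::cu_semigroup \<Rightarrow> 'c::cu_semigroup) \<Rightarrow> bool"
  where "cu_bimorphism f \<longleftrightarrow>
    (\<forall>a a' b. f (a + a') b = f a b + f a' b) \<and> (\<forall>a b b'. f a (b + b') = f a b + f a b') \<and>
    (\<forall>b. f 0 b = 0) \<and> (\<forall>a. f a 0 = 0) \<and>
    (\<forall>b. mono (\<lambda>a. f a b)) \<and> (\<forall>a. mono (f a)) \<and>
    (\<forall>c d. increasing c \<and> increasing d \<longrightarrow>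
      lub (range (\<lambda>n. f (c n) (d n))) = f (lub (range c)) (lub (range d))) \<and>
    (\<forall>a' a b' b. a' \<lless> a \<and> b' \<lless> b \<longrightarrow> f a' b' \<lless> f a b)"

lemma is_lub_unique: "is_lub A s \<Longrightarrow> is_lub A t \<Longrightarrow> s = t"
  for s :: "'a::order"
  by (auto simp: is_lub_def intro: antisym)

lemma lub_eqI: "is_lub A s \<Longrightarrow> lub A = s" for s :: "'a::order"
  unfolding lub_def by (blast intro: is_lub_unique)

lemma is_lub_lub:
  "increasing c \<Longrightarrow> is_lub (range c) (lub (range c))" for c :: "nat \<Rightarrow> 'a::cu_semigroup"
  using O1[of c] lub_eqI[of "range c"] by auto

lemma increasing_le: "increasing c \<Longrightarrow> m \<le> n \<Longrightarrow> c m \<le> c n" for c :: "nat \<Rightarrow> 'a::order"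
  unfolding increasing_def by (rule lift_Suc_mono_le) auto

lemma is_lubD1: "is_lub (range c) s \<Longrightarrow> c n \<le> s" for s :: "'a::order"
  by (auto simp: is_lub_def)

lemma lub_upper: "increasing c \<Longrightarrow> c n \<le> lub (range c)" for c :: "nat \<Rightarrow> 'a::cu_semigroup"
  by (rule is_lubD1[OF is_lub_lub])

lemma lub_least: "increasing c \<Longrightarrow> (\<And>n. c n \<le> u) \<Longrightarrow> lub (range c) \<le> u"
  for c :: "nat \<Rightarrow> 'a::cu_semigroup"
  using is_lub_lub[of c] unfolding is_lub_def by blast

lemma way_belowD:
  "a \<lless> b \<Longrightarrow> increasing c \<Longrightarrow> is_lub (range c) s \<Longrightarrow> b \<le> s \<Longrightarrow> \<exists>k. a \<le> c k"
  for a :: "'a::order"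
  unfolding way_below_def by blast

lemma way_below_le: "a \<lless> b \<Longrightarrow> a \<le> b" for a :: "'a::order"
proof -
  assume "a \<lless> b"
  moreover have "increasing (\<lambda>_::nat. b)" "is_lub (range (\<lambda>_::nat. b)) b"
    by (auto simp: increasing_def is_lub_def)
  ultimately have "\<exists>k::nat. a \<le> b" by (rule way_belowD) simp
  then show ?thesis by simp
qed

lemma le_way_below: "a \<le> b \<Longrightarrow> b \<lless> c \<Longrightarrow> a \<lless> c" for a :: "'a::order"
  unfolding way_below_def using order_trans[of a b] by blast

lemma way_below_trans_le: "a \<lless> b \<Longrightarrow> b \<le> c \<Longrightarrow> a \<lless> c" for a :: "'a::order"
  unfolding way_below_def using order_trans[of b c] by blast

lemma way_below_trans: "a \<lless> b \<Longrightarrow> b \<lless> c \<Longrightarrow> a \<lless> c" for a :: "'a::order"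
  by (rule way_below_trans_le[OF _ way_below_le])

lemma zero_way_below: "0 \<lless> a" for a :: "'a::cu_semigroup"
  by (auto simp: way_below_def zero_least)

lemma O2_seq:
  fixes a :: "'a::cu_semigroup"
  shows "\<exists>c. increasing c \<and> is_lub (range c) a \<and> (\<forall>n. c n \<lless> c (Suc n)) \<and> (\<forall>n. c n \<lless> a) \<and>
    (\<forall>a'. a' \<lless> a \<longrightarrow> (\<exists>n. a' \<lless> c n))"
proof -
  obtain c where c: "\<forall>n. c n \<lless> c (Suc n)" "is_lub (range c) a"
    using O2 by blast
  have i: "increasing c" using c way_below_le by (auto simp: increasing_def)
  have "c n \<lless> a" for n
    using c is_lubD1[OF c(2)] way_below_trans_le by blast
  moreover have "\<exists>n. a' \<lless> c n" if "a' \<lless> a" for a'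
    using way_belowD[OF that i c(2)] c(1) le_way_below by blast
  ultimately show ?thesis using c i by blast
qed

lemma way_below_interpolate: "a \<lless> b \<Longrightarrow> \<exists>c. a \<lless> c \<and> c \<lless> b" for a :: "'a::cu_semigroup"
  using O2_seq[of b] by blast

lemma is_lub_add:
  fixes s :: "'a::cu_semigroup"
  assumes "increasing c" "increasing d" "is_lub (range c) s" "is_lub (range d) t"
  shows "is_lub (range (\<lambda>n. c n + d n)) (s + t)"
proof -
  have "increasing (\<lambda>n. c n + d n)"
    using assms(1,2) by (auto simp: increasing_def intro: add_mono)
  from is_lub_lub[OF this] show ?thesis
    by (simp add: O4[OF assms(1,2)] lub_eqI[OF assms(3)] lub_eqI[OF assms(4)])
qed

subsection \<open>The tensor product\<close>

text \<open>
  A multiset stands for the formal sum of the elementary tensors \<open>a \<otimes> b\<close> of its members.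
  \<open>tensor_le\<close> is the preorder of the algebraic tensor product of positively ordered monoids, and
  \<open>tensor_prec\<close> is the auxiliary relation that \<open>\<lless>\<close> induces on it.
  \<open>S \<otimes> T\<close> is the Cu-completion of this structure, given by its countably generated round ideals.
  The universal property is \<open>tensor_universal\<close> below.
\<close>

inductive tensor_le ::
    "('a::cu_semigroup \<times> 'b::cu_semigroup) multiset \<Rightarrow> ('a \<times> 'b) multiset \<Rightarrow> bool"
    (infix "\<sqsubseteq>" 50)
  where
    refl: "u \<sqsubseteq> u"
  | trans: "u \<sqsubseteq> v \<Longrightarrow> v \<sqsubseteq> w \<Longrightarrow> u \<sqsubseteq> w"
  | add: "u \<sqsubseteq> v \<Longrightarrow> u' \<sqsubseteq> v' \<Longrightarrow> u + u' \<sqsubseteq> v + v'"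
  | mono: "a \<le> a' \<Longrightarrow> b \<le> b' \<Longrightarrow> {#(a, b)#} \<sqsubseteq> {#(a', b')#}"
  | zero: "{#} \<sqsubseteq> {#(a, b)#}"
  | zero_left: "{#(0, b)#} \<sqsubseteq> {#}"
  | zero_right: "{#(a, 0)#} \<sqsubseteq> {#}"
  | add_left1: "{#(a + a', b)#} \<sqsubseteq> {#(a, b), (a', b)#}"
  | add_left2: "{#(a, b), (a', b)#} \<sqsubseteq> {#(a + a', b)#}"
  | add_right1: "{#(a, b + b')#} \<sqsubseteq> {#(a, b), (a, b')#}"
  | add_right2: "{#(a, b), (a, b')#} \<sqsubseteq> {#(a, b + b')#}"

definition tensor_ll ::
    "('a::cu_semigroup \<times> 'b::cu_semigroup) multiset \<Rightarrow> ('a \<times> 'b) multiset \<Rightarrow> bool"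
  where "tensor_ll = rel_mset (rel_prod (\<lless>) (\<lless>))"

definition tensor_prec ::
    "('a::cu_semigroup \<times> 'b::cu_semigroup) multiset \<Rightarrow> ('a \<times> 'b) multiset \<Rightarrow> bool"
    (infix "\<lhd>" 50)
  where "u \<lhd> v \<longleftrightarrow> (\<exists>v'. u \<sqsubseteq> v' \<and> tensor_ll v' v)"

definition round_ideal :: "('a::cu_semigroup \<times> 'b::cu_semigroup) multiset set \<Rightarrow> bool"
  where "round_ideal I \<longleftrightarrow>
    (\<exists>c :: nat \<Rightarrow> _. I = {u. \<exists>n. u \<sqsubseteq> c n}) \<and> (\<forall>u\<in>I. \<forall>v\<in>I. \<exists>w\<in>I. u \<lhd> w \<and> v \<lhd> w)"

lemma tll_empty: "tensor_ll {#} {#}"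
  by (simp add: tensor_ll_def)

lemma tll_add_mset:
  "a' \<lless> a \<Longrightarrow> b' \<lless> b \<Longrightarrow> tensor_ll u' u \<Longrightarrow> tensor_ll (add_mset (a', b') u') (add_mset (a, b) u)"
  unfolding tensor_ll_def by (rule rel_mset_Plus) auto

lemma tll_induct[consumes 1, case_names empty add]:
  assumes "tensor_ll u v" "P {#} {#}"
    "\<And>a' a b' b u v. a' \<lless> a \<Longrightarrow> b' \<lless> b \<Longrightarrow> tensor_ll u v \<Longrightarrow> P u v
      \<Longrightarrow> P (add_mset (a', b') u) (add_mset (a, b) v)"
  shows "P u v"
  using assms(1) unfolding tensor_ll_def
proof (induction "rel_prod (\<lless>) (\<lless>) :: 'a \<times> 'b \<Rightarrow> 'a \<times> 'b \<Rightarrow> bool" u v rule: rel_mset_induct)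
  case empty show ?case by (rule assms(2))
next
  case (add p q u v)
  then show ?case using assms(3)[of "fst p" "fst q" "snd p" "snd q" u v]
    by (cases p; cases q) (auto simp: tensor_ll_def)
qed

lemma tll_add: "tensor_ll u' u \<Longrightarrow> tensor_ll v' v \<Longrightarrow> tensor_ll (u' + v') (u + v)"
  by (induction rule: tll_induct) (auto intro: tll_add_mset)

lemma tll_splitR:
  assumes "tensor_ll w (u + v)" obtains u' v' where "w = u' + v'" "tensor_ll u' u" "tensor_ll v' v"
proof -
  have "\<exists>u' v'. w = u' + v' \<and> tensor_ll u' u \<and> tensor_ll v' v"
    using assms
  proof (induction u arbitrary: w)
    case empty
    then show ?case by (intro exI[of _ "{#}"] exI[of _ w]) (auto simp: tll_empty)
  next
    case (add x u)
    obtain w1 y where w: "w = add_mset y w1" "rel_prod (\<lless>) (\<lless>) y x" "tensor_ll w1 (u + v)"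
      using msed_rel_invR[of "rel_prod (\<lless>) (\<lless>)" w x "u + v"] add.prems
      by (auto simp: tensor_ll_def)
    from add.IH[OF w(3)] obtain u' v' where "w1 = u' + v'" "tensor_ll u' u" "tensor_ll v' v" by blast
    moreover from this have "tensor_ll (add_mset y u') (add_mset x u)"
      using w(2) by (cases x; cases y) (auto intro: tll_add_mset)
    ultimately show ?case using w(1)
      by (intro exI[of _ "add_mset y u'"] exI[of _ v']) auto
  qed
  then show ?thesis using that by blast
qed

lemma tll_singleR:
  assumes "tensor_ll w {#(a, b)#}" obtains a' b' where "w = {#(a', b')#}" "a' \<lless> a" "b' \<lless> b"
  using assms msed_rel_invR[of "rel_prod (\<lless>) (\<lless>)" w "(a,b)" "{#}"]
  by (auto simp: tensor_ll_def elim!: rel_prod.cases)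

lemma tll_emptyR: "tensor_ll w {#} \<Longrightarrow> w = {#}"
  by (simp add: tensor_ll_def)

lemma tll_single: "a' \<lless> a \<Longrightarrow> b' \<lless> b \<Longrightarrow> tensor_ll {#(a', b')#} {#(a, b)#}"
  by (rule tll_add_mset[OF _ _ tll_empty])

lemma tll_le: "tensor_ll u v \<Longrightarrow> u \<sqsubseteq> v"
proof (induction rule: tll_induct)
  case (add a' a b' b u v)
  have "{#(a', b')#} \<sqsubseteq> {#(a, b)#}" using add by (intro tensor_le.mono way_below_le)
  from tensor_le.add[OF this add.IH] show ?case by simp
qed (rule tensor_le.refl)

lemma empty_le: "{#} \<sqsubseteq> u"
proof (induction u)
  case (add x u)
  have "{#} \<sqsubseteq> {#x#}" by (cases x) (auto intro: tensor_le.zero)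
  from tensor_le.add[OF this add.IH] show ?case by simp
qed (rule tensor_le.refl)

lemma pair_upper:
  fixes c :: "'a::cu_semigroup"
  assumes "a \<lless> c" "b \<lless> c" obtains d where "a \<le> d" "b \<le> d" "d \<lless> c"
proof -
  obtain s where s: "increasing s" "\<And>n. s n \<lless> c" "\<And>a'. a' \<lless> c \<Longrightarrow> \<exists>n. a' \<lless> s n"
    using O2_seq[of c] by blast
  obtain m n where "a \<lless> s m" "b \<lless> s n" using assms s(3) by blast
  then have "a \<le> s (max m n)" "b \<le> s (max m n)"
    using way_below_le increasing_le[OF s(1)] by (meson max.cobounded1 max.cobounded2 order_trans)+
  then show ?thesis using that s(2) by blast
qed

lemma sum_below:
  fixes c :: "'a::cu_semigroup"
  assumes "c \<lless> a + b" obtains a' b' where "a' \<lless> a" "b' \<lless> b" "c \<le> a' + b'"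
proof -
  obtain s where s: "increasing s" "is_lub (range s) a" "\<And>n. s n \<lless> a" using O2_seq[of a] by blast
  obtain t where t: "increasing t" "is_lub (range t) b" "\<And>n. t n \<lless> b" using O2_seq[of b] by blast
  have "increasing (\<lambda>n. s n + t n)"
    using s(1) t(1) by (auto simp: increasing_def intro: add_mono)
  from way_belowD[OF assms this is_lub_add[OF s(1) t(1) s(2) t(2)]]
  show ?thesis using that s(3) t(3) by blast
qed

lemma tll_le_continuous:
  assumes "u \<sqsubseteq> v" "tensor_ll u' u" shows "\<exists>v'. u' \<sqsubseteq> v' \<and> tensor_ll v' v"
  using assms
proof (induction arbitrary: u' rule: tensor_le.induct)
  case (refl u) then show ?case using tensor_le.refl by blast
next
  case (trans u v w)
  then show ?case using tensor_le.trans by meson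
next
  case (add u v x y)
  from add.prems obtain u1 x1 where "u' = u1 + x1" "tensor_ll u1 u" "tensor_ll x1 x"
    by (rule tll_splitR)
  then show ?case using add.IH tensor_le.add tll_add by meson
next
  case (mono a a' b b')
  from mono.prems obtain x y where "u' = {#(x,y)#}" "x \<lless> a" "y \<lless> b" by (rule tll_singleR)
  then show ?case using mono.hyps tensor_le.refl tll_single way_below_trans_le by metis
next
  case (zero a b)
  then have "u' = {#}" using tll_emptyR by blast
  then show ?case using zero_way_below tll_single tensor_le.zero by metis
next
  case (zero_left b)
  then obtain x y where "u' = {#(x,y)#}" "x \<lless> 0" "y \<lless> b" by (elim tll_singleR)
  moreover from this have "x = 0" using way_below_le zero_least antisym by metis
  ultimately show ?case using tll_empty tensor_le.zero_left by metis
next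
  case (zero_right a)
  then obtain x y where "u' = {#(x,y)#}" "x \<lless> a" "y \<lless> 0" by (elim tll_singleR)
  moreover from this have "y = 0" using way_below_le zero_least antisym by metis
  ultimately show ?case using tll_empty tensor_le.zero_right by metis
next
  case (add_left1 a a' b)
  then obtain x y where xy: "u' = {#(x,y)#}" "x \<lless> a + a'" "y \<lless> b" by (elim tll_singleR)
  then obtain p q where pq: "p \<lless> a" "q \<lless> a'" "x \<le> p + q" by (elim sum_below)
  have "u' \<sqsubseteq> {#(p, y), (q, y)#}"
    unfolding xy(1) by (rule tensor_le.trans[OF tensor_le.mono[OF pq(3) order_refl] tensor_le.add_left1])
  moreover have "tensor_ll {#(p, y), (q, y)#} {#(a, b), (a', b)#}"
    by (intro tll_add_mset pq xy tll_empty)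
  ultimately show ?case by blast
next
  case (add_left2 a b a')
  from add_left2 have "tensor_ll u' ({#(a, b)#} + {#(a', b)#})" by (simp add: add_mset_commute)
  then obtain u1 u2 where u: "u' = u1 + u2" "tensor_ll u1 {#(a,b)#}" "tensor_ll u2 {#(a',b)#}"
    by (rule tll_splitR)
  from u(2) obtain p y where 1: "u1 = {#(p,y)#}" "p \<lless> a" "y \<lless> b" by (rule tll_singleR)
  from u(3) obtain q z where 2: "u2 = {#(q,z)#}" "q \<lless> a'" "z \<lless> b" by (rule tll_singleR)
  from 1(3) 2(3) obtain d where d: "y \<le> d" "z \<le> d" "d \<lless> b" by (rule pair_upper)
  have "{#(p,y)#} + {#(q,z)#} \<sqsubseteq> {#(p,d)#} + {#(q,d)#}"
    by (intro tensor_le.add tensor_le.mono d order_refl)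
  also have "{#(p,d)#} + {#(q,d)#} = {#(p,d),(q,d)#}" by simp
  finally have "u' \<sqsubseteq> {#(p + q, d)#}"
    using tensor_le.trans[OF _ tensor_le.add_left2] u(1) 1(1) 2(1) by metis
  moreover have "tensor_ll {#(p + q, d)#} {#(a + a', b)#}"
    by (intro tll_single O3 1 2 d)
  ultimately show ?case by blast
next
  case (add_right1 a b b')
  then obtain x y where xy: "u' = {#(x,y)#}" "x \<lless> a" "y \<lless> b + b'" by (elim tll_singleR)
  then obtain p q where pq: "p \<lless> b" "q \<lless> b'" "y \<le> p + q" by (elim sum_below)
  have "u' \<sqsubseteq> {#(x, p), (x, q)#}"
    unfolding xy(1) by (rule tensor_le.trans[OF tensor_le.mono[OF order_refl pq(3)] tensor_le.add_right1])
  moreover have "tensor_ll {#(x, p), (x, q)#} {#(a, b), (a, b')#}"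
    by (intro tll_add_mset pq xy tll_empty)
  ultimately show ?case by blast
next
  case (add_right2 a b b')
  from add_right2 have "tensor_ll u' ({#(a, b)#} + {#(a, b')#})" by (simp add: add_mset_commute)
  then obtain u1 u2 where u: "u' = u1 + u2" "tensor_ll u1 {#(a,b)#}" "tensor_ll u2 {#(a,b')#}"
    by (rule tll_splitR)
  from u(2) obtain p y where 1: "u1 = {#(p,y)#}" "p \<lless> a" "y \<lless> b" by (rule tll_singleR)
  from u(3) obtain q z where 2: "u2 = {#(q,z)#}" "q \<lless> a" "z \<lless> b'" by (rule tll_singleR)
  from 1(2) 2(2) obtain d where d: "p \<le> d" "q \<le> d" "d \<lless> a" by (rule pair_upper)
  have "{#(p,y)#} + {#(q,z)#} \<sqsubseteq> {#(d,y)#} + {#(d,z)#}"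
    by (intro tensor_le.add tensor_le.mono d order_refl)
  also have "{#(d,y)#} + {#(d,z)#} = {#(d,y),(d,z)#}" by simp
  finally have "u' \<sqsubseteq> {#(d, y + z)#}"
    using tensor_le.trans[OF _ tensor_le.add_right2] u(1) 1(1) 2(1) by metis
  moreover have "tensor_ll {#(d, y + z)#} {#(a, b + b')#}"
    by (intro tll_single O3 1 2 d)
  ultimately show ?case by blast
qed

lemma tll_seq: "\<exists>s. (\<forall>n. tensor_ll (s n) (s (Suc n)) \<and> tensor_ll (s n) w) \<and>
    (\<forall>w'. tensor_ll w' w \<longrightarrow> (\<exists>n. tensor_ll w' (s n)))"
proof (induction w)
  case empty
  then show ?case by (intro exI[of _ "\<lambda>_. {#}"]) (auto simp: tll_empty dest: tll_emptyR)
next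
  case (add x w)
  obtain a b where x: "x = (a, b)" by (cases x)
  obtain s where s: "\<And>n. tensor_ll (s n) (s (Suc n))" "\<And>n. tensor_ll (s n) w"
    "\<And>w'. tensor_ll w' w \<Longrightarrow> \<exists>n. tensor_ll w' (s n)" using add by blast
  obtain c where c: "increasing c" "\<And>n. c n \<lless> c (Suc n)" "\<And>n. c n \<lless> a"
    "\<And>a'. a' \<lless> a \<Longrightarrow> \<exists>n. a' \<lless> c n" using O2_seq[of a] by blast
  obtain d where d: "increasing d" "\<And>n. d n \<lless> d (Suc n)" "\<And>n. d n \<lless> b"
    "\<And>a'. a' \<lless> b \<Longrightarrow> \<exists>n. a' \<lless> d n" using O2_seq[of b] by blast
  have tr: "tensor_ll u w \<Longrightarrow> tensor_ll u v" if "tensor_ll w v" for u v w :: "('a \<times> 'b) multiset"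
  proof -
    assume "tensor_ll u w"
    with that have "(rel_mset (rel_prod (\<lless>) (\<lless>)) OO rel_mset (rel_prod (\<lless>) (\<lless>))) u v"
      unfolding tensor_ll_def by blast
    then have "rel_mset (rel_prod (\<lless>) (\<lless>) OO rel_prod (\<lless>) (\<lless>)) u v"
      by (simp add: multiset.rel_compp)
    then show ?thesis unfolding tensor_ll_def
      by (rule multiset.rel_mono_strong) (auto intro: way_below_trans elim!: rel_prod.cases)
  qed
  have smono: "tensor_ll u (s m) \<Longrightarrow> m \<le> n \<Longrightarrow> tensor_ll u (s n)" for u m n
  proof (induction n)
    case (Suc n) then show ?case using s(1) tr by (metis le_Suc_eq)
  qed auto
  have "tensor_ll (add_mset (c n, d n) (s n)) (add_mset (c (Suc n), d (Suc n)) (s (Suc n)))"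
    "tensor_ll (add_mset (c n, d n) (s n)) (add_mset x w)" for n
    unfolding x using c(2,3) d(2,3) s by (auto intro: tll_add_mset)
  moreover have "\<exists>n. tensor_ll w' (add_mset (c n, d n) (s n))" if "tensor_ll w' (add_mset x w)" for w'
  proof -
    from that have "tensor_ll w' ({#(a,b)#} + w)" by (simp add: x)
    then obtain u v where u: "w' = u + v" "tensor_ll u {#(a,b)#}" "tensor_ll v w" by (rule tll_splitR)
    from u(2) obtain a' b' where ab: "u = {#(a',b')#}" "a' \<lless> a" "b' \<lless> b" by (rule tll_singleR)
    obtain i j k where ijk: "a' \<lless> c i" "b' \<lless> d j" "tensor_ll v (s k)"
      using ab c(4) d(4) s(3) u(3) by blast
    define n where "n = max i (max j k)"
    have "c i \<le> c n" unfolding n_def by (intro increasing_le[OF c(1)]) simp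
    moreover have "d j \<le> d n" unfolding n_def by (intro increasing_le[OF d(1)]) simp
    moreover have "tensor_ll v (s n)" unfolding n_def by (rule smono[OF ijk(3)]) simp
    ultimately have "a' \<lless> c n" "b' \<lless> d n" "tensor_ll v (s n)"
      using ijk way_below_trans_le by blast+
    then show ?thesis unfolding u(1) ab(1) by (auto intro!: exI[of _ n] tll_add_mset)
  qed
  ultimately show ?case by (intro exI[of _ "\<lambda>n. add_mset (c n, d n) (s n)"]) blast
qed

lemma prec_le: "u \<lhd> v \<Longrightarrow> u \<sqsubseteq> v"
  unfolding tensor_prec_def using tll_le tensor_le.trans by blast

lemma le_prec: "u \<sqsubseteq> v \<Longrightarrow> v \<lhd> w \<Longrightarrow> u \<lhd> w"
  unfolding tensor_prec_def using tensor_le.trans by blast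

lemma prec_le_trans: "u \<lhd> v \<Longrightarrow> v \<sqsubseteq> w \<Longrightarrow> u \<lhd> w"
  unfolding tensor_prec_def using tensor_le.trans tll_le_continuous by blast

lemma prec_add: "u \<lhd> v \<Longrightarrow> u' \<lhd> v' \<Longrightarrow> u + u' \<lhd> v + v'"
  unfolding tensor_prec_def using tensor_le.add tll_add by blast

lemma ll_prec: "tensor_ll u v \<Longrightarrow> u \<lhd> v"
  unfolding tensor_prec_def using tensor_le.refl by blast

lemma prec_seq:
  "\<exists>s. (\<forall>n. s n \<lhd> s (Suc n)) \<and> (\<forall>n. tensor_ll (s n) w) \<and> (\<forall>u. u \<lhd> w \<longrightarrow> (\<exists>n. u \<lhd> s n))"
proof -
  obtain s where s: "\<And>n. tensor_ll (s n) (s (Suc n))" "\<And>n. tensor_ll (s n) w"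
    "\<And>w'. tensor_ll w' w \<Longrightarrow> \<exists>n. tensor_ll w' (s n)" using tll_seq[of w] by blast
  have "\<exists>n. u \<lhd> s n" if "u \<lhd> w" for u
    using that s(3) le_prec ll_prec unfolding tensor_prec_def[of _ w] by blast
  with s show ?thesis using ll_prec by blast
qed

lemma round_idealI:
  assumes "\<And>n. s n \<lhd> s (Suc n)" "\<And>n. s n \<in> I" "\<And>u. u \<in> I \<Longrightarrow> \<exists>n::nat. u \<sqsubseteq> s n"
    "\<And>u v. u \<sqsubseteq> v \<Longrightarrow> v \<in> I \<Longrightarrow> u \<in> I"
  shows "round_ideal I"
proof -
  have le: "s m \<sqsubseteq> s n" if "m \<le> n" for m n
    using that by (induction n) (auto simp: le_Suc_eq intro: tensor_le.refl tensor_le.trans prec_le assms(1))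
  have "I = {u. \<exists>n. u \<sqsubseteq> s n}" using assms by blast
  moreover have "\<exists>w\<in>I. u \<lhd> w \<and> v \<lhd> w" if uv: "u \<in> I" "v \<in> I" for u v
  proof -
    obtain m n where "u \<sqsubseteq> s m" "v \<sqsubseteq> s n" using assms(3) uv by blast
    then have "u \<sqsubseteq> s (max m n)" "v \<sqsubseteq> s (max m n)"
      using le tensor_le.trans by (meson max.cobounded1 max.cobounded2)+
    then show ?thesis using assms(1,2) le_prec by blast
  qed
  ultimately show ?thesis unfolding round_ideal_def by blast
qed

lemma round_ideal_down: "round_ideal I \<Longrightarrow> u \<sqsubseteq> v \<Longrightarrow> v \<in> I \<Longrightarrow> u \<in> I"
  unfolding round_ideal_def using tensor_le.trans by auto

lemma round_ideal_nonempty: "round_ideal I \<Longrightarrow> I \<noteq> {}"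
  unfolding round_ideal_def using tensor_le.refl by blast

lemma round_ideal_directed:
  "round_ideal I \<Longrightarrow> u \<in> I \<Longrightarrow> v \<in> I \<Longrightarrow> \<exists>w\<in>I. u \<lhd> w \<and> v \<lhd> w"
  unfolding round_ideal_def by blast

lemma round_ideal_seq:
  assumes "round_ideal I"
  shows "\<exists>s. (\<forall>n. s n \<lhd> s (Suc n)) \<and> (\<forall>n. s n \<in> I) \<and> (\<forall>u\<in>I. \<exists>n. u \<lhd> s n)"
proof -
  obtain c :: "nat \<Rightarrow> _" where c: "I = {u. \<exists>n. u \<sqsubseteq> c n}" using assms unfolding round_ideal_def by blast
  have cI: "c n \<in> I" for n using c tensor_le.refl by blast
  have "\<exists>s. \<forall>n. (s n \<in> I \<and> c n \<lhd> s n) \<and> s n \<lhd> s (Suc n)"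
  proof (rule dependent_nat_choice)
    show "\<exists>x. x \<in> I \<and> c 0 \<lhd> x" using round_ideal_directed[OF assms cI cI] by blast
    show "\<exists>y. (y \<in> I \<and> c (Suc n) \<lhd> y) \<and> x \<lhd> y" if "x \<in> I \<and> c n \<lhd> x" for x n
      using round_ideal_directed[OF assms cI, of x "Suc n"] that by blast
  qed
  then obtain s where s: "\<And>n. s n \<in> I" "\<And>n. c n \<lhd> s n" "\<And>n. s n \<lhd> s (Suc n)" by blast
  moreover have "\<exists>n. u \<lhd> s n" if "u \<in> I" for u using that s(2) le_prec unfolding c by blast
  ultimately show ?thesis by blast
qed

lemma round_ideal_prec: "round_ideal {u. u \<lhd> w}"
proof -
  obtain s where s: "\<And>n. s n \<lhd> s (Suc n)" "\<And>n. tensor_ll (s n) w" "\<And>u. u \<lhd> w \<Longrightarrow> \<exists>n. u \<lhd> s n"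
    using prec_seq[of w] by blast
  show ?thesis
    by (rule round_idealI[of s]) (use s ll_prec prec_le le_prec in blast)+
qed

lemma round_ideal_add:
  assumes "round_ideal I" "round_ideal J"
  shows "round_ideal {w. \<exists>u\<in>I. \<exists>v\<in>J. w \<sqsubseteq> u + v}"
proof -
  obtain s where s: "\<And>n. s n \<lhd> s (Suc n)" "\<And>n. s n \<in> I" "\<And>u. u \<in> I \<Longrightarrow> \<exists>n::nat. u \<lhd> s n"
    using round_ideal_seq[OF assms(1)] by blast
  obtain t where t: "\<And>n. t n \<lhd> t (Suc n)" "\<And>n. t n \<in> J" "\<And>u. u \<in> J \<Longrightarrow> \<exists>n::nat. u \<lhd> t n"
    using round_ideal_seq[OF assms(2)] by blast
  have sle: "s m \<sqsubseteq> s n" if "m \<le> n" for m n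
    using that by (induction n) (auto simp: le_Suc_eq intro: tensor_le.refl tensor_le.trans prec_le s(1))
  have tle: "t m \<sqsubseteq> t n" if "m \<le> n" for m n
    using that by (induction n) (auto simp: le_Suc_eq intro: tensor_le.refl tensor_le.trans prec_le t(1))
  show ?thesis
  proof (rule round_idealI[of "\<lambda>n. s n + t n"])
    show "s n + t n \<lhd> s (Suc n) + t (Suc n)" for n using s t prec_add by blast
    show "s n + t n \<in> {w. \<exists>u\<in>I. \<exists>v\<in>J. w \<sqsubseteq> u + v}" for n using s t tensor_le.refl by blast
    show "u \<sqsubseteq> v \<Longrightarrow> v \<in> {w. \<exists>u\<in>I. \<exists>v\<in>J. w \<sqsubseteq> u + v} \<Longrightarrow> u \<in> {w. \<exists>u\<in>I. \<exists>v\<in>J. w \<sqsubseteq> u + v}" for u v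
      using tensor_le.trans by blast
    fix w assume "w \<in> {w. \<exists>u\<in>I. \<exists>v\<in>J. w \<sqsubseteq> u + v}"
    then obtain u v where w: "u \<in> I" "v \<in> J" "w \<sqsubseteq> u + v" by blast
    then obtain m n where "u \<sqsubseteq> s m" "v \<sqsubseteq> t n" using s t prec_le by meson
    then have "u \<sqsubseteq> s (max m n)" "v \<sqsubseteq> t (max m n)"
      using sle tle tensor_le.trans by (meson max.cobounded1 max.cobounded2)+
    then show "\<exists>n. w \<sqsubseteq> s n + t n" using w(3) tensor_le.add tensor_le.trans by blast
  qed
qed

lemma round_ideal_Union:
  assumes "\<And>n. round_ideal (I n)" "\<And>n. I n \<subseteq> I (Suc n)"
  shows "round_ideal (\<Union>n::nat. I n)"
proof -
  have mono: "I m \<subseteq> I n" if "m \<le> n" for m n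
    using that assms(2) by (rule lift_Suc_mono_le[rotated])
  have "\<exists>c::nat \<Rightarrow> _. I n = {u. \<exists>k. u \<sqsubseteq> c k}" for n using assms(1) unfolding round_ideal_def by blast
  then obtain c :: "nat \<Rightarrow> nat \<Rightarrow> _" where c: "\<And>n. I n = {u. \<exists>k. u \<sqsubseteq> c n k}" by metis
  have "(\<Union>n. I n) = {u. \<exists>k. u \<sqsubseteq> (case prod_decode k of (i, j) \<Rightarrow> c i j)}"
  proof (intro equalityI subsetI)
    fix u assume "u \<in> (\<Union>n. I n)"
    then obtain i j where "u \<sqsubseteq> c i j" using c by blast
    then show "u \<in> {u. \<exists>k. u \<sqsubseteq> (case prod_decode k of (i, j) \<Rightarrow> c i j)}"
      by (auto intro!: exI[of _ "prod_encode (i, j)"])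
  next
    fix u assume "u \<in> {u. \<exists>k. u \<sqsubseteq> (case prod_decode k of (i, j) \<Rightarrow> c i j)}"
    then obtain k where "u \<sqsubseteq> c (fst (prod_decode k)) (snd (prod_decode k))" by (auto simp: case_prod_beta)
    then show "u \<in> (\<Union>n. I n)" using c by blast
  qed
  then have "\<exists>c::nat \<Rightarrow> _. (\<Union>n. I n) = {u. \<exists>k. u \<sqsubseteq> c k}" by (rule exI[where x = "\<lambda>k. case prod_decode k of (i, j) \<Rightarrow> c i j"])
  moreover have "\<exists>w\<in>\<Union>n. I n. u \<lhd> w \<and> v \<lhd> w" if uv: "u \<in> (\<Union>n. I n)" "v \<in> (\<Union>n. I n)" for u v
  proof -
    from uv obtain m n where "u \<in> I m" "v \<in> I n" by blast
    then have "u \<in> I (max m n)" "v \<in> I (max m n)" using mono by (meson max.cobounded1 max.cobounded2 subsetD)+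
    then show ?thesis using round_ideal_directed[OF assms(1)] by blast
  qed
  ultimately show ?thesis unfolding round_ideal_def by (intro conjI ballI)
qed

typedef (overloaded) ('a::cu_semigroup, 'b::cu_semigroup) tensor (infixr "\<otimes>" 70) =
  "{I :: ('a \<times> 'b) multiset set. round_ideal I}"
  morphisms ideal_of Abs_tensor
  by (rule exI[of _ "{u. u \<lhd> {#}}"]) (simp add: round_ideal_prec)

setup_lifting type_definition_tensor

lift_definition tensor_elem :: "('a::cu_semigroup \<times> 'b::cu_semigroup) multiset \<Rightarrow> 'a \<otimes> 'b"
  is "\<lambda>w. {u. u \<lhd> w}"
  by (rule round_ideal_prec)

definition tensor_of :: "'a::cu_semigroup \<Rightarrow> 'b::cu_semigroup \<Rightarrow> 'a \<otimes> 'b"  (infixr "\<otimes>" 70)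
  where "a \<otimes> b = tensor_elem {#(a, b)#}"

instantiation tensor :: (cu_semigroup, cu_semigroup) positively_ordered_semigroup
begin

lift_definition zero_tensor :: "'a \<otimes> 'b" is "{u. u \<lhd> {#}}"
  by (rule round_ideal_prec)

lift_definition plus_tensor :: "'a \<otimes> 'b \<Rightarrow> 'a \<otimes> 'b \<Rightarrow> 'a \<otimes> 'b"
  is "\<lambda>I J. {w. \<exists>u\<in>I. \<exists>v\<in>J. w \<sqsubseteq> u + v}"
  by (rule round_ideal_add)

lift_definition less_eq_tensor :: "'a \<otimes> 'b \<Rightarrow> 'a \<otimes> 'b \<Rightarrow> bool" is "(\<subseteq>)" .

definition less_tensor :: "'a \<otimes> 'b \<Rightarrow> 'a \<otimes> 'b \<Rightarrow> bool"
  where "less_tensor x y \<longleftrightarrow> x \<le> y \<and> \<not> y \<le> x"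

instance
proof
  fix x y z :: "'a \<otimes> 'b"
  show "x < y \<longleftrightarrow> x \<le> y \<and> \<not> y \<le> x" by (rule less_tensor_def)
  show "x \<le> x" by transfer simp
  show "x \<le> y \<Longrightarrow> y \<le> z \<Longrightarrow> x \<le> z" by transfer auto
  show "x \<le> y \<Longrightarrow> y \<le> x \<Longrightarrow> x = y" by transfer auto
  show "x + y = y + x" by transfer (metis (no_types, opaque_lifting) add.commute)
  show "x \<le> y \<Longrightarrow> z + x \<le> z + y" by transfer blast
  show "0 \<le> x"
  proof transfer
    fix I :: "('a \<times> 'b) multiset set" assume I: "round_ideal I"
    then obtain v where "v \<in> I" using round_ideal_nonempty by blast
    then show "{u. u \<lhd> {#}} \<subseteq> I"
      using round_ideal_down[OF I] prec_le empty_le tensor_le.trans by blast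
  qed
  show "0 + x = x"
  proof transfer
    fix I :: "('a \<times> 'b) multiset set" assume I: "round_ideal I"
    have "w \<in> I" if "u \<lhd> {#}" "v \<in> I" "w \<sqsubseteq> u + v" for u v w
    proof -
      have "u + v \<sqsubseteq> {#} + v" using that prec_le tensor_le.add tensor_le.refl by blast
      then show ?thesis using that round_ideal_down[OF I] tensor_le.trans[of w "u + v" v] by simp
    qed
    moreover have "\<exists>u\<in>{u. u \<lhd> {#}}. \<exists>v\<in>I. w \<sqsubseteq> u + v" if "w \<in> I" for w
    proof (intro bexI)
      show "w \<sqsubseteq> {#} + w" by (simp add: tensor_le.refl)
      show "{#} \<in> {u. u \<lhd> {#}}" by (simp add: ll_prec tll_empty)
    qed (rule that)
    ultimately show "{w. \<exists>u\<in>{u. u \<lhd> {#}}. \<exists>v\<in>I. w \<sqsubseteq> u + v} = I" by blast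
  qed
  show "x + y + z = x + (y + z)"
  proof transfer
    fix I J K :: "('a \<times> 'b) multiset set"
    have "p \<sqsubseteq> u + (v + w)" if "p \<sqsubseteq> q + w" "q \<sqsubseteq> u + v" for p q u v w :: "('a \<times> 'b) multiset"
      using tensor_le.trans[OF that(1) tensor_le.add[OF that(2) tensor_le.refl]] by (simp add: add.assoc)
    moreover have "p \<sqsubseteq> (u + v) + w" if "p \<sqsubseteq> u + q" "q \<sqsubseteq> v + w" for p q u v w :: "('a \<times> 'b) multiset"
      using tensor_le.trans[OF that(1) tensor_le.add[OF tensor_le.refl that(2)]] by (simp add: add.assoc)
    ultimately show "{w. \<exists>u\<in>{w. \<exists>u\<in>I. \<exists>v\<in>J. w \<sqsubseteq> u + v}. \<exists>v\<in>K. w \<sqsubseteq> u + v} =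
       {w. \<exists>u\<in>I. \<exists>v\<in>{w. \<exists>u\<in>J. \<exists>v\<in>K. w \<sqsubseteq> u + v}. w \<sqsubseteq> u + v}"
      using tensor_le.refl by blast
  qed
qed

end

lemma round_ideal_of: "round_ideal (ideal_of x)"
  using ideal_of by auto

lemma tensor_is_lub:
  fixes c :: "nat \<Rightarrow> 'a::cu_semigroup \<otimes> 'b::cu_semigroup"
  assumes "increasing c"
  shows "\<exists>s. is_lub (range c) s \<and> ideal_of s = (\<Union>n. ideal_of (c n))"
proof -
  let ?s = "Abs_tensor (\<Union>n. ideal_of (c n))"
  have "round_ideal (\<Union>n. ideal_of (c n))"
    using assms by (intro round_ideal_Union round_ideal_of) (auto simp: increasing_def less_eq_tensor.rep_eq)
  then have s: "ideal_of ?s = (\<Union>n. ideal_of (c n))"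
    by (simp add: Abs_tensor_inverse)
  then have "is_lub (range c) ?s"
    unfolding is_lub_def less_eq_tensor.rep_eq by blast
  with s show ?thesis by blast
qed

lemma ideal_of_lub:
  "increasing c \<Longrightarrow> is_lub (range c) s \<Longrightarrow> ideal_of s = (\<Union>n. ideal_of (c n))"
  using tensor_is_lub[of c] is_lub_unique[of "range c" s] by metis

lemma ideal_of_increasing:
  "increasing c \<Longrightarrow> m \<le> n \<Longrightarrow> ideal_of (c m) \<subseteq> ideal_of (c n)"
  using increasing_le[of c m n] by (simp add: less_eq_tensor.rep_eq)

lemma tensor_expand:
  fixes x :: "'a::cu_semigroup \<otimes> 'b::cu_semigroup"
  shows "\<exists>s. (\<forall>n. s n \<lhd> s (Suc n)) \<and> (\<forall>n. s n \<in> ideal_of x) \<and>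
    increasing (\<lambda>n. tensor_elem (s n)) \<and> is_lub (range (\<lambda>n. tensor_elem (s n))) x"
proof -
  obtain s where s: "\<And>n. s n \<lhd> s (Suc n)" "\<And>n. s n \<in> ideal_of x" "\<And>u. u \<in> ideal_of x \<Longrightarrow> \<exists>n::nat. u \<lhd> s n"
    using round_ideal_seq[OF round_ideal_of[of x]] by blast
  have i: "increasing (\<lambda>n. tensor_elem (s n))"
    unfolding increasing_def less_eq_tensor.rep_eq tensor_elem.rep_eq
    using s(1) prec_le prec_le_trans by blast
  obtain t where t: "is_lub (range (\<lambda>n. tensor_elem (s n))) t" "ideal_of t = (\<Union>n. ideal_of (tensor_elem (s n)))"
    using tensor_is_lub[OF i] by blast
  have "ideal_of t = ideal_of x"
  proof (intro equalityI subsetI)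
    fix u assume "u \<in> ideal_of t"
    then obtain n where "u \<lhd> s n" unfolding t(2) tensor_elem.rep_eq by blast
    then show "u \<in> ideal_of x" using round_ideal_down[OF round_ideal_of prec_le s(2)] by blast
  next
    fix u assume "u \<in> ideal_of x"
    then show "u \<in> ideal_of t" unfolding t(2) tensor_elem.rep_eq using s(3) by blast
  qed
  then have "t = x" by (simp add: ideal_of_inject)
  with s(1,2) i t(1) show ?thesis by blast
qed

lemma tensor_way_below_iff:
  "x \<lless> y \<longleftrightarrow> (\<exists>w\<in>ideal_of y. \<forall>u\<in>ideal_of x. u \<sqsubseteq> w)"
proof
  assume xy: "x \<lless> y"
  obtain s where s: "\<And>n. s n \<in> ideal_of y" "increasing (\<lambda>n. tensor_elem (s n))"
    "is_lub (range (\<lambda>n. tensor_elem (s n))) y"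
    using tensor_expand[of y] by blast
  obtain k where "x \<le> tensor_elem (s k)" using way_belowD[OF xy s(2,3)] by blast
  then have "\<forall>u\<in>ideal_of x. u \<sqsubseteq> s k"
    unfolding less_eq_tensor.rep_eq tensor_elem.rep_eq using prec_le by blast
  with s(1) show "\<exists>w\<in>ideal_of y. \<forall>u\<in>ideal_of x. u \<sqsubseteq> w" by blast
next
  assume "\<exists>w\<in>ideal_of y. \<forall>u\<in>ideal_of x. u \<sqsubseteq> w"
  then obtain w where w: "w \<in> ideal_of y" "\<And>u. u \<in> ideal_of x \<Longrightarrow> u \<sqsubseteq> w" by blast
  show "x \<lless> y"
    unfolding way_below_def
  proof (intro allI impI, elim conjE)
    fix c :: "nat \<Rightarrow> 'a \<otimes> 'b" and s assume c: "increasing c" "is_lub (range c) s" "y \<le> s"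
    then have "w \<in> (\<Union>n. ideal_of (c n))"
      using ideal_of_lub[OF c(1,2)] w(1) by (auto simp: less_eq_tensor.rep_eq)
    then obtain k where "w \<in> ideal_of (c k)" by blast
    then have "x \<le> c k"
      unfolding less_eq_tensor.rep_eq using w(2) round_ideal_down[OF round_ideal_of] by blast
    then show "\<exists>k. x \<le> c k" ..
  qed
qed

instance tensor :: (cu_semigroup, cu_semigroup) cu_semigroup
proof
  fix a b a' b' :: "'a \<otimes> 'b" and c d :: "nat \<Rightarrow> 'a \<otimes> 'b"
  show "increasing c \<Longrightarrow> \<exists>s. is_lub (range c) s" using tensor_is_lub by blast
  show "\<exists>c. (\<forall>n. c n \<lless> c (Suc n)) \<and> is_lub (range c) a"
  proof -
    obtain s where s: "\<And>n. s n \<lhd> s (Suc n)" "is_lub (range (\<lambda>n. tensor_elem (s n))) a"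
      using tensor_expand[of a] by blast
    have "tensor_elem (s n) \<lless> tensor_elem (s (Suc n))" for n
      unfolding tensor_way_below_iff tensor_elem.rep_eq using s(1) prec_le by blast
    with s(2) show ?thesis by (intro exI[of _ "\<lambda>n. tensor_elem (s n)"]) simp
  qed
  show "a' + b' \<lless> a + b" if "a' \<lless> a" "b' \<lless> b"
  proof -
    obtain v w where v: "v \<in> ideal_of a" "\<And>u. u \<in> ideal_of a' \<Longrightarrow> u \<sqsubseteq> v"
      and w: "w \<in> ideal_of b" "\<And>u. u \<in> ideal_of b' \<Longrightarrow> u \<sqsubseteq> w"
      using \<open>a' \<lless> a\<close> \<open>b' \<lless> b\<close> unfolding tensor_way_below_iff by blast
    have "v + w \<in> ideal_of (a + b)"
      using v(1) w(1) tensor_le.refl unfolding plus_tensor.rep_eq by blast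
    moreover have "u \<sqsubseteq> v + w" if "u \<in> ideal_of (a' + b')" for u
      using that v(2) w(2) tensor_le.add tensor_le.trans unfolding plus_tensor.rep_eq by blast
    ultimately show ?thesis unfolding tensor_way_below_iff by blast
  qed
  show "lub (range (\<lambda>n. c n + d n)) = lub (range c) + lub (range d)"
    if c: "increasing c" and d: "increasing d"
  proof -
    have i: "increasing (\<lambda>n. c n + d n)"
      using c d by (auto simp: increasing_def intro: add_mono)
    obtain s where s: "is_lub (range c) s" "ideal_of s = (\<Union>n. ideal_of (c n))"
      using tensor_is_lub[OF c] by blast
    obtain t where t: "is_lub (range d) t" "ideal_of t = (\<Union>n. ideal_of (d n))"
      using tensor_is_lub[OF d] by blast
    obtain r where r: "is_lub (range (\<lambda>n. c n + d n)) r" "ideal_of r = (\<Union>n. ideal_of (c n + d n))"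
      using tensor_is_lub[OF i] by blast
    have "ideal_of (s + t) \<subseteq> ideal_of r"
    proof
      fix w assume "w \<in> ideal_of (s + t)"
      then obtain u v m n where w: "u \<in> ideal_of (c m)" "v \<in> ideal_of (d n)" "w \<sqsubseteq> u + v"
        unfolding plus_tensor.rep_eq s(2) t(2) by blast
      then have "u \<in> ideal_of (c (max m n))" "v \<in> ideal_of (d (max m n))"
        using ideal_of_increasing[OF c, of m "max m n"] ideal_of_increasing[OF d, of n "max m n"] by auto
      then show "w \<in> ideal_of r" using w(3) unfolding r(2) plus_tensor.rep_eq by blast
    qed
    moreover have "ideal_of r \<subseteq> ideal_of (s + t)"
      unfolding r(2) plus_tensor.rep_eq s(2) t(2) by blast
    ultimately have "r = s + t" by (simp add: ideal_of_inject[symmetric])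
    then show ?thesis using lub_eqI[OF r(1)] lub_eqI[OF s(1)] lub_eqI[OF t(1)] by simp
  qed
qed

lemma tensor_elem_mono: "u \<sqsubseteq> v \<Longrightarrow> tensor_elem u \<le> tensor_elem v"
  unfolding less_eq_tensor.rep_eq tensor_elem.rep_eq using prec_le_trans by blast

lemma tensor_elem_add: "tensor_elem (u + v) = tensor_elem u + tensor_elem v"
proof -
  have "ideal_of (tensor_elem (u + v)) = ideal_of (tensor_elem u + tensor_elem v)"
    unfolding plus_tensor.rep_eq tensor_elem.rep_eq
  proof (intro equalityI subsetI)
    fix w assume "w \<in> {w. w \<lhd> u + v}"
    then obtain x where x: "w \<sqsubseteq> x" "tensor_ll x (u + v)" unfolding tensor_prec_def by blast
    from x(2) obtain p q where "x = p + q" "tensor_ll p u" "tensor_ll q v" by (rule tll_splitR)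
    then show "w \<in> {w. \<exists>p\<in>{w. w \<lhd> u}. \<exists>q\<in>{w. w \<lhd> v}. w \<sqsubseteq> p + q}"
      using x(1) ll_prec by blast
  next
    fix w assume "w \<in> {w. \<exists>p\<in>{w. w \<lhd> u}. \<exists>q\<in>{w. w \<lhd> v}. w \<sqsubseteq> p + q}"
    then show "w \<in> {w. w \<lhd> u + v}" using prec_add le_prec by blast
  qed
  then show ?thesis by (simp add: ideal_of_inject)
qed

lemma tensor_elem_empty: "tensor_elem {#} = 0"
  by (simp add: ideal_of_inject[symmetric] tensor_elem.rep_eq zero_tensor.rep_eq)

lemma tensor_elem_way_below: "u \<lhd> v \<Longrightarrow> tensor_elem u \<lless> tensor_elem v"
  unfolding tensor_way_below_iff tensor_elem.rep_eq using prec_le by blast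

lemma le_interpolate_lub:
  fixes a :: "'a::cu_semigroup"
  assumes "a \<lless> lub (range c)" "increasing c" shows "\<exists>k. a \<lless> c k"
  using way_below_interpolate[OF assms(1)] way_belowD[OF _ assms(2) is_lub_lub[OF assms(2)]]
    way_below_trans_le by blast


lemma cu_morphism_gen: "cu_morphism f \<Longrightarrow> gen_cu_morphism f"
  by (simp add: cu_morphism_def)

lemma gen_cu_morphismD:
  assumes "gen_cu_morphism f"
  shows "f (a + b) = f a + f b" "f 0 = 0" "mono f" "a \<le> b \<Longrightarrow> f a \<le> f b"
    "increasing c \<Longrightarrow> increasing (\<lambda>n. f (c n))"
    "increasing c \<Longrightarrow> f (lub (range c)) = lub (range (\<lambda>n. f (c n)))"
    "increasing c \<Longrightarrow> is_lub (range c) s \<Longrightarrow> is_lub (range (\<lambda>n. f (c n))) (f s)"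
proof -
  show *: "f (a + b) = f a + f b" "f 0 = 0" "mono f"
    "increasing c \<Longrightarrow> f (lub (range c)) = lub (range (\<lambda>n. f (c n)))"
    using assms by (auto simp: gen_cu_morphism_def)
  show "a \<le> b \<Longrightarrow> f a \<le> f b" by (rule monoD[OF *(3)])
  show i: "increasing c \<Longrightarrow> increasing (\<lambda>n. f (c n))"
    using monoD[OF *(3)] by (simp add: increasing_def)
  show "is_lub (range (\<lambda>n. f (c n))) (f s)" if "increasing c" "is_lub (range c) s"
    using is_lub_lub[OF i[OF that(1)]] *(4)[OF that(1)] lub_eqI[OF that(2)] by simp
qed

lemma cu_bimorphismD:
  assumes "cu_bimorphism f"
  shows "f (a + a') b = f a b + f a' b" "f a (b + b') = f a b + f a b'"
    "f 0 b = 0" "f a 0 = 0" "a \<le> a' \<Longrightarrow> b \<le> b' \<Longrightarrow> f a b \<le> f a' b'"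
    "increasing c \<Longrightarrow> increasing d \<Longrightarrow>
      lub (range (\<lambda>n. f (c n) (d n))) = f (lub (range c)) (lub (range d))"
    "a' \<lless> a \<Longrightarrow> b' \<lless> b \<Longrightarrow> f a' b' \<lless> f a b"
proof -
  show "f (a + a') b = f a b + f a' b" "f a (b + b') = f a b + f a b'" "f 0 b = 0" "f a 0 = 0"
    using assms by (simp_all add: cu_bimorphism_def)
  show "f a b \<le> f a' b'" if "a \<le> a'" "b \<le> b'"
  proof -
    have "mono (\<lambda>a. f a b)" "mono (f a')" using assms by (simp_all add: cu_bimorphism_def)
    from monoD[OF this(1) that(1)] monoD[OF this(2) that(2)] show ?thesis by simp
  qed
  show "lub (range (\<lambda>n. f (c n) (d n))) = f (lub (range c)) (lub (range d))"
    if "increasing c" "increasing d" using assms that by (simp add: cu_bimorphism_def)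
  show "f a' b' \<lless> f a b" if "a' \<lless> a" "b' \<lless> b"
    using assms that unfolding cu_bimorphism_def by blast
qed

lemma cu_bimorphism_tensor_of:
  "cu_bimorphism ((\<otimes>) :: 'a::cu_semigroup \<Rightarrow> 'b::cu_semigroup \<Rightarrow> 'a \<otimes> 'b)"
proof -
  have le: "a \<otimes> b \<le> a' \<otimes> b'" if "a \<le> a'" "b \<le> b'" for a a' :: 'a and b b' :: 'b
    unfolding tensor_of_def by (intro tensor_elem_mono tensor_le.mono that)
  have ll: "a' \<otimes> b' \<lless> a \<otimes> b" if "a' \<lless> a" "b' \<lless> b" for a a' :: 'a and b b' :: 'b
    unfolding tensor_of_def by (intro tensor_elem_way_below ll_prec tll_single that)
  have zero: "0 \<otimes> b = 0" "a \<otimes> 0 = 0" for a :: 'a and b :: 'b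
    unfolding tensor_of_def tensor_elem_empty[symmetric]
    by (auto intro!: antisym tensor_elem_mono tensor_le.zero_left tensor_le.zero_right tensor_le.zero)
  have add1: "(a + a') \<otimes> b = a \<otimes> b + a' \<otimes> b" for a a' :: 'a and b :: 'b
    unfolding tensor_of_def tensor_elem_add[symmetric]
    using tensor_le.add_left1[of a a' b] tensor_le.add_left2[of a b a']
    by (auto intro!: antisym tensor_elem_mono simp: add_mset_commute)
  have add2: "a \<otimes> (b + b') = a \<otimes> b + a \<otimes> b'" for a :: 'a and b b' :: 'b
    unfolding tensor_of_def tensor_elem_add[symmetric]
    using tensor_le.add_right1[of a b b'] tensor_le.add_right2[of a b b']
    by (auto intro!: antisym tensor_elem_mono simp: add_mset_commute)
  have sup: "lub (range (\<lambda>n. c n \<otimes> d n)) = lub (range c) \<otimes> lub (range d)"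
    if c: "increasing c" and d: "increasing d" for c :: "nat \<Rightarrow> 'a" and d :: "nat \<Rightarrow> 'b"
  proof (rule antisym)
    have i: "increasing (\<lambda>n. c n \<otimes> d n)" using c d le by (simp add: increasing_def)
    show "lub (range (\<lambda>n. c n \<otimes> d n)) \<le> lub (range c) \<otimes> lub (range d)"
      by (intro lub_least[OF i] le lub_upper c d)
    show "lub (range c) \<otimes> lub (range d) \<le> lub (range (\<lambda>n. c n \<otimes> d n))"
      unfolding less_eq_tensor.rep_eq ideal_of_lub[OF i is_lub_lub[OF i]]
    proof
      fix u assume "u \<in> ideal_of (lub (range c) \<otimes> lub (range d))"
      then obtain v where v: "u \<sqsubseteq> v" "tensor_ll v {#(lub (range c), lub (range d))#}"
        by (auto simp: tensor_of_def tensor_elem.rep_eq tensor_prec_def)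
      from v(2) obtain a b where ab: "v = {#(a, b)#}" "a \<lless> lub (range c)" "b \<lless> lub (range d)"
        by (rule tll_singleR)
      obtain m n where mn: "a \<lless> c m" "b \<lless> d n"
        using le_interpolate_lub[OF ab(2) c] le_interpolate_lub[OF ab(3) d] by blast
      define k where "k = max m n"
      have "c m \<le> c k" "d n \<le> d k" using increasing_le[OF c] increasing_le[OF d] by (simp_all add: k_def)
      with mn have "a \<lless> c k" "b \<lless> d k" using way_below_trans_le by blast+
      then have "u \<lhd> {#(c k, d k)#}" unfolding tensor_prec_def using v(1) ab(1) tll_single by blast
      then show "u \<in> (\<Union>n. ideal_of (c n \<otimes> d n))" by (auto simp: tensor_of_def tensor_elem.rep_eq)
    qed
  qed
  show ?thesis unfolding cu_bimorphism_def mono_def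
    using le ll zero add1 add2 sup by auto
qed

lemma tensor_le_ext:
  assumes "cu_bimorphism f" "u \<sqsubseteq> v"
  shows "(\<Sum>(a, b)\<in>#u. f a b) \<le> (\<Sum>(a, b)\<in>#v. f a b)"
  using assms(2)
proof (induction rule: tensor_le.induct)
  case (trans u v w)
  from trans.IH show ?case by (rule order_trans)
qed (auto simp: zero_least add_mono cu_bimorphismD(1-5)[OF assms(1)])

lemma tensor_ll_ext:
  assumes "cu_bimorphism f" "tensor_ll u v"
  shows "(\<Sum>(a, b)\<in>#u. f a b) \<lless> (\<Sum>(a, b)\<in>#v. f a b)"
  using assms(2)
  by (induction rule: tll_induct)
    (auto simp: zero_way_below intro: O3 cu_bimorphismD(7)[OF assms(1)])

lemma tensor_prec_ext:
  assumes "cu_bimorphism f" "u \<lhd> v"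
  shows "(\<Sum>(a, b)\<in>#u. f a b) \<lless> (\<Sum>(a, b)\<in>#v. f a b)"
proof -
  obtain w where w: "u \<sqsubseteq> w" "tensor_ll w v" using assms(2) unfolding tensor_prec_def by blast
  show ?thesis by (rule le_way_below[OF tensor_le_ext[OF assms(1) w(1)] tensor_ll_ext[OF assms(1) w(2)]])
qed

lemma tensor_morphism_le:
  assumes f: "gen_cu_morphism f" and g: "gen_cu_morphism g"
    and le: "\<And>a b. f (a \<otimes> b) \<le> g (a \<otimes> b)"
  shows "f x \<le> g x"
proof -
  have elem: "f (tensor_elem w) \<le> g (tensor_elem w)" for w
  proof (induction w)
    case empty
    then show ?case by (simp add: tensor_elem_empty gen_cu_morphismD(2)[OF f] gen_cu_morphismD(2)[OF g])
  next
    case (add p w)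
    have "tensor_elem (add_mset p w) = fst p \<otimes> snd p + tensor_elem w"
      using tensor_elem_add[of "{#p#}" w] by (simp add: tensor_of_def)
    then show ?case
      using add_mono[OF le[of "fst p" "snd p"] add.IH]
      by (simp add: gen_cu_morphismD(1)[OF f] gen_cu_morphismD(1)[OF g])
  qed
  obtain s where s: "increasing (\<lambda>n. tensor_elem (s n))" "is_lub (range (\<lambda>n. tensor_elem (s n))) x"
    using tensor_expand[of x] by blast
  have F: "is_lub (range (\<lambda>n. f (tensor_elem (s n)))) (f x)" by (rule gen_cu_morphismD(7)[OF f s])
  have G: "is_lub (range (\<lambda>n. g (tensor_elem (s n)))) (g x)" by (rule gen_cu_morphismD(7)[OF g s])
  have "f (tensor_elem (s n)) \<le> g x" for n
    using elem is_lubD1[OF G] order_trans by blast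
  then show ?thesis using F unfolding is_lub_def by blast
qed

lemma tensor_universal_ex:
  fixes f :: "'a::cu_semigroup \<Rightarrow> 'b::cu_semigroup \<Rightarrow> 'c::cu_semigroup"
  assumes f: "cu_bimorphism f"
  shows "\<exists>h. cu_morphism h \<and> (\<forall>a b. h (a \<otimes> b) = f a b)"
proof -
  define e where "e w = (\<Sum>(a, b)\<in>#w. f a b)" for w
  have e_le: "u \<sqsubseteq> v \<Longrightarrow> e u \<le> e v" and e_ll: "u \<lhd> v \<Longrightarrow> e u \<lless> e v"
    and e_add: "e (u + v) = e u + e v" and e_empty: "e {#} = 0" and e_single: "e {#(a, b)#} = f a b" for u v a b
    using tensor_le_ext[OF f] tensor_prec_ext[OF f] by (auto simp: e_def)
  define h where "h x = lub (e ` ideal_of x)" for x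
  have h: "is_lub (e ` ideal_of x) (h x) \<and>
    (\<exists>s. increasing (\<lambda>n. e (s n)) \<and> is_lub (range (\<lambda>n. e (s n))) (h x) \<and> (\<forall>n. s n \<in> ideal_of x))" for x
  proof -
    obtain s where s: "\<And>n. s n \<lhd> s (Suc n)" "\<And>n. s n \<in> ideal_of x" "\<And>u. u \<in> ideal_of x \<Longrightarrow> \<exists>n::nat. u \<lhd> s n"
      using round_ideal_seq[OF round_ideal_of[of x]] by blast
    have i: "increasing (\<lambda>n. e (s n))" unfolding increasing_def using e_le[OF prec_le[OF s(1)]] by blast
    have "e u \<le> lub (range (\<lambda>n. e (s n)))" if u: "u \<in> ideal_of x" for u
    proof -
      obtain n where "u \<lhd> s n" using s(3)[OF u] by blast
      from order_trans[OF e_le[OF prec_le[OF this]] lub_upper[OF i]] show ?thesis .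
    qed
    moreover have "lub (range (\<lambda>n. e (s n))) \<le> t" if "\<forall>u\<in>ideal_of x. e u \<le> t" for t
      using lub_least[OF i, of t] that s(2) by blast
    ultimately have l: "is_lub (e ` ideal_of x) (lub (range (\<lambda>n. e (s n))))"
      unfolding is_lub_def by blast
    then have hx: "h x = lub (range (\<lambda>n. e (s n)))" unfolding h_def by (rule lub_eqI)
    show ?thesis using l is_lub_lub[OF i] i s(2) unfolding hx by (intro conjI exI[of _ s]) auto
  qed
  have h_upper: "u \<in> ideal_of x \<Longrightarrow> e u \<le> h x" for u x using h[of x] unfolding is_lub_def by blast
  have h_least: "(\<And>u. u \<in> ideal_of x \<Longrightarrow> e u \<le> t) \<Longrightarrow> h x \<le> t" for x t
    using h[of x] unfolding is_lub_def by blast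
  have h_mono: "x \<le> y \<Longrightarrow> h x \<le> h y" for x y
    unfolding less_eq_tensor.rep_eq using h_upper by (intro h_least) blast
  have h_add: "h (x + y) = h x + h y" for x y
  proof (rule antisym)
    show "h (x + y) \<le> h x + h y"
    proof (rule h_least)
      fix w assume "w \<in> ideal_of (x + y)"
      then obtain u v where uv: "u \<in> ideal_of x" "v \<in> ideal_of y" "w \<sqsubseteq> u + v"
        unfolding plus_tensor.rep_eq by blast
      have "e w \<le> e u + e v" using e_le[OF uv(3)] e_add by simp
      also have "\<dots> \<le> h x + h y" using uv(1,2) h_upper by (intro add_mono)
      finally show "e w \<le> h x + h y" .
    qed
    obtain s where s: "increasing (\<lambda>n. e (s n))" "is_lub (range (\<lambda>n. e (s n))) (h x)" "\<And>n. s n \<in> ideal_of x"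
      using h[of x] by blast
    obtain t where t: "increasing (\<lambda>n. e (t n))" "is_lub (range (\<lambda>n. e (t n))) (h y)" "\<And>n. t n \<in> ideal_of y"
      using h[of y] by blast
    have "e (s n) + e (t n) \<le> h (x + y)" for n
    proof -
      have "s n + t n \<in> ideal_of (x + y)"
        unfolding plus_tensor.rep_eq using s(3) t(3) tensor_le.refl by blast
      then show ?thesis using h_upper e_add by metis
    qed
    then show "h x + h y \<le> h (x + y)"
      using is_lub_add[OF s(1) t(1) s(2) t(2)] unfolding is_lub_def by blast
  qed
  have h_zero: "h 0 = 0"
  proof (rule antisym)
    show "h 0 \<le> 0"
    proof (rule h_least)
      fix u :: "('a \<times> 'b) multiset" assume "u \<in> ideal_of 0"
      then have "u \<sqsubseteq> {#}" by (simp add: zero_tensor.rep_eq prec_le)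
      then show "e u \<le> 0" using e_le e_empty by metis
    qed
  qed (rule zero_least)
  have h_sup: "h (lub (range c)) = lub (range (\<lambda>n. h (c n)))" if c: "increasing c" for c
  proof (rule antisym)
    have i: "increasing (\<lambda>n. h (c n))" using c h_mono by (simp add: increasing_def)
    show "h (lub (range c)) \<le> lub (range (\<lambda>n. h (c n)))"
    proof (rule h_least)
      fix u assume "u \<in> ideal_of (lub (range c))"
      then obtain n where "u \<in> ideal_of (c n)" using ideal_of_lub[OF c is_lub_lub[OF c]] by blast
      then show "e u \<le> lub (range (\<lambda>n. h (c n)))"
        using h_upper lub_upper[OF i, of n] order_trans by blast
    qed
    show "lub (range (\<lambda>n. h (c n))) \<le> h (lub (range c))"
      by (intro lub_least[OF i] h_mono lub_upper[OF c])
  qed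
  have h_ll: "h x \<lless> h y" if "x \<lless> y" for x y
  proof -
    obtain w where w: "w \<in> ideal_of y" "\<And>u. u \<in> ideal_of x \<Longrightarrow> u \<sqsubseteq> w"
      using \<open>x \<lless> y\<close> unfolding tensor_way_below_iff by blast
    obtain v where v: "v \<in> ideal_of y" "w \<lhd> v"
      using round_ideal_directed[OF round_ideal_of w(1) w(1)] by blast
    have "h x \<le> e w" using w(2) e_le by (intro h_least) blast
    also have "e w \<lless> e v" by (rule e_ll[OF v(2)])
    finally (le_way_below) have "h x \<lless> e v" .
    then show ?thesis by (rule way_below_trans_le) (rule h_upper[OF v(1)])
  qed
  have "cu_morphism h"
    unfolding cu_morphism_def gen_cu_morphism_def mono_def
    using h_add h_zero h_mono h_sup h_ll by blast
  moreover have "h (a \<otimes> b) = f a b" for a b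
  proof (rule antisym)
    show "h (a \<otimes> b) \<le> f a b"
    proof (rule h_least)
      fix u assume "u \<in> ideal_of (a \<otimes> b)"
      then have "u \<sqsubseteq> {#(a, b)#}" by (simp add: tensor_of_def tensor_elem.rep_eq prec_le)
      then show "e u \<le> f a b" using e_le e_single by metis
    qed
    obtain c where c: "increasing c" "is_lub (range c) a" "\<And>n. c n \<lless> a"
      using O2_seq[of a] by blast
    obtain d where d: "increasing d" "is_lub (range d) b" "\<And>n. d n \<lless> b"
      using O2_seq[of b] by blast
    have i: "increasing (\<lambda>n. f (c n) (d n))"
      using c(1) d(1) cu_bimorphismD(5)[OF f] by (simp add: increasing_def)
    have "f (c n) (d n) \<le> h (a \<otimes> b)" for n
    proof -
      have "{#(c n, d n)#} \<in> ideal_of (a \<otimes> b)"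
        by (simp add: tensor_of_def tensor_elem.rep_eq ll_prec tll_single c(3) d(3))
      from h_upper[OF this] show ?thesis by (simp add: e_single)
    qed
    then have "lub (range (\<lambda>n. f (c n) (d n))) \<le> h (a \<otimes> b)" by (rule lub_least[OF i])
    then show "f a b \<le> h (a \<otimes> b)"
      using cu_bimorphismD(6)[OF f c(1) d(1)] lub_eqI[OF c(2)] lub_eqI[OF d(2)] by simp
  qed
  ultimately show ?thesis by blast
qed

theorem tensor_universal_le:
  assumes "cu_morphism g" "cu_morphism g'"
  shows "(\<forall>x. g x \<le> g' x) \<longleftrightarrow> (\<forall>a b. g (a \<otimes> b) \<le> g' (a \<otimes> b))"
  using tensor_morphism_le[OF assms[THEN cu_morphism_gen]] by blast

theorem tensor_universal:
  fixes f :: "'a::cu_semigroup \<Rightarrow> 'b::cu_semigroup \<Rightarrow> 'c::cu_semigroup"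
  assumes "cu_bimorphism f"
  shows "\<exists>!h. cu_morphism h \<and> (\<forall>a b. h (a \<otimes> b) = f a b)"
proof -
  obtain h where h: "cu_morphism h" "\<And>a b. h (a \<otimes> b) = f a b"
    using tensor_universal_ex[OF assms] by blast
  show ?thesis
  proof (rule ex1I[of _ h])
    show "cu_morphism h \<and> (\<forall>a b. h (a \<otimes> b) = f a b)" using h by simp
    fix g assume g: "cu_morphism g \<and> (\<forall>a b. g (a \<otimes> b) = f a b)"
    then have gm: "cu_morphism g" by simp
    have "\<forall>x. g x \<le> h x" by (subst tensor_universal_le[OF gm h(1)]) (simp add: g h(2))
    moreover have "\<forall>x. h x \<le> g x" by (subst tensor_universal_le[OF h(1) gm]) (simp add: g h(2))
    ultimately show "g = h" by (intro ext antisym) simp_all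
  qed
qed


subsection \<open>The internal hom\<close>

definition cu_prec ::
    "('a::cu_semigroup \<Rightarrow> 'b::cu_semigroup) \<Rightarrow> ('a \<Rightarrow> 'b) \<Rightarrow> bool"  (infix "\<prec>" 50)
  where "f \<prec> g \<longleftrightarrow> (\<forall>a' a. a' \<lless> a \<longrightarrow> f a' \<lless> g a)"

definition IQ :: "rat set"
  where "IQ = {0<..<1}"

text \<open>
  A path is a total function on \<^typ>\<open>rat\<close> of which only the values on \<^const>\<open>IQ\<close> matter: the
  relation \<open>path_equiv\<close> below does not see the others.
\<close>

definition is_path :: "(rat \<Rightarrow> 'a::cu_semigroup \<Rightarrow> 'b::cu_semigroup) \<Rightarrow> bool"
  where "is_path f \<longleftrightarrow>
    (\<forall>l\<in>IQ. gen_cu_morphism (f l)) \<and> (\<forall>l'\<in>IQ. \<forall>l\<in>IQ. l' < l \<longrightarrow> f l' \<prec> f l)"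

definition path_le ::
    "(rat \<Rightarrow> 'a::cu_semigroup \<Rightarrow> 'b::cu_semigroup) \<Rightarrow> (rat \<Rightarrow> 'a \<Rightarrow> 'b) \<Rightarrow> bool"
    (infix "\<lesssim>" 50)
  where "f \<lesssim> g \<longleftrightarrow> (\<forall>l\<in>IQ. \<exists>m\<in>IQ. f l \<prec> g m)"

definition path_equiv ::
    "(rat \<Rightarrow> 'a::cu_semigroup \<Rightarrow> 'b::cu_semigroup) \<Rightarrow> (rat \<Rightarrow> 'a \<Rightarrow> 'b) \<Rightarrow> bool"
  where "path_equiv f g \<longleftrightarrow> is_path f \<and> is_path g \<and> f \<lesssim> g \<and> g \<lesssim> f"

lemma cu_prec_le:
  assumes "f \<prec> g" "gen_cu_morphism f" "gen_cu_morphism g" shows "f a \<le> g a"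
proof -
  obtain c where c: "increasing c" "is_lub (range c) a" "\<And>n. c n \<lless> a"
    using O2_seq[of a] by blast
  have "f (c n) \<le> g a" for n
    using assms(1) c(3) way_below_le unfolding cu_prec_def by blast
  then show ?thesis
    using gen_cu_morphismD(7)[OF assms(2) c(1,2)] unfolding is_lub_def by blast
qed

lemma cu_prec_le_trans: "f \<prec> g \<Longrightarrow> (\<And>a. g a \<le> h a) \<Longrightarrow> f \<prec> h"
  unfolding cu_prec_def using way_below_trans_le by blast

lemma cu_le_prec_trans: "(\<And>a. f a \<le> g a) \<Longrightarrow> g \<prec> h \<Longrightarrow> f \<prec> h"
  unfolding cu_prec_def using le_way_below by blast

lemma cu_prec_trans:
  "f \<prec> g \<Longrightarrow> g \<prec> h \<Longrightarrow> gen_cu_morphism g \<Longrightarrow> gen_cu_morphism h \<Longrightarrow> f \<prec> h"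
  by (rule cu_prec_le_trans[of f g h]) (auto intro: cu_prec_le)

lemma cu_prec_add: "f \<prec> g \<Longrightarrow> f' \<prec> g' \<Longrightarrow> (\<lambda>a. f a + f' a) \<prec> (\<lambda>a. g a + g' a)"
  unfolding cu_prec_def using O3 by blast

lemma gen_cu_morphism_add:
  assumes f: "gen_cu_morphism f" and g: "gen_cu_morphism g"
  shows "gen_cu_morphism (\<lambda>a. f a + g a)"
  unfolding gen_cu_morphism_def
proof (intro conjI allI impI)
  show "mono (\<lambda>a. f a + g a)"
    by (intro monoI add_mono gen_cu_morphismD(4)[OF f] gen_cu_morphismD(4)[OF g])
  show "f (lub (range c)) + g (lub (range c)) = lub (range (\<lambda>n. f (c n) + g (c n)))"
    if "increasing c" for c
    using O4[OF gen_cu_morphismD(5)[OF f that] gen_cu_morphismD(5)[OF g that]]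
      gen_cu_morphismD(6)[OF f that] gen_cu_morphismD(6)[OF g that] by simp
qed (simp_all add: gen_cu_morphismD[OF f] gen_cu_morphismD[OF g] add_ac)

lemma gen_cu_morphism_zero:
  "gen_cu_morphism (\<lambda>_::'a::cu_semigroup. 0::'b::cu_semigroup)"
proof -
  have "is_lub {0::'b} 0" by (simp add: is_lub_def)
  from lub_eqI[OF this] show ?thesis by (simp add: gen_cu_morphism_def mono_def)
qed

lemma pathD:
  assumes "is_path f"
  shows "l \<in> IQ \<Longrightarrow> gen_cu_morphism (f l)" "l' \<in> IQ \<Longrightarrow> l \<in> IQ \<Longrightarrow> l' < l \<Longrightarrow> f l' \<prec> f l"
    "l' \<in> IQ \<Longrightarrow> l \<in> IQ \<Longrightarrow> l' \<le> l \<Longrightarrow> f l' a \<le> f l a"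
proof -
  show *: "l \<in> IQ \<Longrightarrow> gen_cu_morphism (f l)" "l' \<in> IQ \<Longrightarrow> l \<in> IQ \<Longrightarrow> l' < l \<Longrightarrow> f l' \<prec> f l" for l l'
    using assms unfolding is_path_def by blast+
  show "f l' a \<le> f l a" if "l' \<in> IQ" "l \<in> IQ" "l' \<le> l"
    using that *(1)[of l] *(1)[of l'] *(2)[of l' l] cu_prec_le[of "f l'" "f l" a] by (cases "l' = l") auto
qed

lemma IQ_greater: "l \<in> IQ \<Longrightarrow> \<exists>m\<in>IQ. l < m"
  unfolding IQ_def using dense[of l 1] by force

lemma IQ_max: "l \<in> IQ \<Longrightarrow> m \<in> IQ \<Longrightarrow> max l m \<in> IQ"
  by (simp add: max_def)

lemma path_le_refl: "is_path f \<Longrightarrow> f \<lesssim> f"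
  unfolding path_le_def using IQ_greater pathD(2) by meson

lemma path_le_trans:
  assumes "is_path g" "is_path h" "f \<lesssim> g" "g \<lesssim> h" shows "f \<lesssim> h"
  unfolding path_le_def
proof
  fix l assume "l \<in> IQ"
  then obtain m where m: "m \<in> IQ" "f l \<prec> g m" using assms(3) unfolding path_le_def by blast
  then obtain k where k: "k \<in> IQ" "g m \<prec> h k" using assms(4) unfolding path_le_def by blast
  have "f l \<prec> h k" using cu_prec_trans[OF m(2) k(2)] pathD(1) assms(1,2) m(1) k(1) by blast
  with k(1) show "\<exists>m\<in>IQ. f l \<prec> h m" by blast
qed

lemma path_add:
  "is_path f \<Longrightarrow> is_path g \<Longrightarrow> is_path (\<lambda>l a. f l a + g l a)"
  unfolding is_path_def by (simp add: gen_cu_morphism_add cu_prec_add)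

lemma path_zero: "is_path (\<lambda>_ _. 0)"
  unfolding is_path_def by (simp add: gen_cu_morphism_zero cu_prec_def zero_way_below)

lemma path_le_add:
  assumes "is_path f'" "is_path g'" "f \<lesssim> f'" "g \<lesssim> g'"
  shows "(\<lambda>l a. f l a + g l a) \<lesssim> (\<lambda>l a. f' l a + g' l a)"
  unfolding path_le_def
proof
  fix l assume l: "l \<in> IQ"
  obtain m where m: "m \<in> IQ" "f l \<prec> f' m" using l assms(3) unfolding path_le_def by blast
  obtain k where k: "k \<in> IQ" "g l \<prec> g' k" using l assms(4) unfolding path_le_def by blast
  have M: "max m k \<in> IQ" by (rule IQ_max[OF m(1) k(1)])
  have "f l \<prec> f' (max m k)"
    by (rule cu_prec_le_trans[OF m(2) pathD(3)[OF assms(1) m(1) M]]) simp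
  moreover have "g l \<prec> g' (max m k)"
    by (rule cu_prec_le_trans[OF k(2) pathD(3)[OF assms(2) k(1) M]]) simp
  ultimately show "\<exists>n\<in>IQ. (\<lambda>a. f l a + g l a) \<prec> (\<lambda>a. f' n a + g' n a)"
    using cu_prec_add M by blast
qed

quotient_type (overloaded) ('a, 'b) ihom =
    "rat \<Rightarrow> 'a::cu_semigroup \<Rightarrow> 'b::cu_semigroup" / partial: path_equiv
proof (rule part_equivpI)
  show "\<exists>f :: rat \<Rightarrow> 'a \<Rightarrow> 'b. path_equiv f f"
    using path_zero path_le_refl unfolding path_equiv_def by blast
  show "symp (path_equiv :: (rat \<Rightarrow> 'a \<Rightarrow> 'b) \<Rightarrow> _)"
    unfolding symp_def path_equiv_def by blast
  show "transp (path_equiv :: (rat \<Rightarrow> 'a \<Rightarrow> 'b) \<Rightarrow> _)"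
    unfolding transp_def path_equiv_def by (meson path_le_trans)
qed

instantiation ihom :: (cu_semigroup, cu_semigroup) positively_ordered_semigroup
begin

lift_definition zero_ihom :: "('a, 'b) ihom" is "\<lambda>_ _. 0"
  unfolding path_equiv_def by (simp add: path_zero path_le_refl)

lift_definition plus_ihom :: "('a, 'b) ihom \<Rightarrow> ('a, 'b) ihom \<Rightarrow> ('a, 'b) ihom"
  is "\<lambda>f g l a. f l a + g l a"
  unfolding path_equiv_def by (simp add: path_add path_le_add)

lift_definition less_eq_ihom :: "('a, 'b) ihom \<Rightarrow> ('a, 'b) ihom \<Rightarrow> bool" is "(\<lesssim>)"
  unfolding path_equiv_def by (meson path_le_trans)

definition less_ihom :: "('a, 'b) ihom \<Rightarrow> ('a, 'b) ihom \<Rightarrow> bool"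
  where "less_ihom x y \<longleftrightarrow> x \<le> y \<and> \<not> y \<le> x"

instance
proof
  fix x y z :: "('a, 'b) ihom"
  show "x < y \<longleftrightarrow> x \<le> y \<and> \<not> y \<le> x" by (rule less_ihom_def)
  show "x \<le> x" by transfer (simp add: path_equiv_def)
  show "x \<le> y \<Longrightarrow> y \<le> z \<Longrightarrow> x \<le> z" by transfer (auto simp: path_equiv_def intro: path_le_trans)
  show "x \<le> y \<Longrightarrow> y \<le> x \<Longrightarrow> x = y" by transfer (simp add: path_equiv_def)
  show "x + y = y + x"
    by transfer (simp add: path_equiv_def path_add path_le_refl add.commute)
  show "x + y + z = x + (y + z)"
    by transfer (simp add: path_equiv_def path_add path_le_refl add.assoc)
  show "0 + x = x" by transfer (simp add: path_equiv_def)
  show "x \<le> y \<Longrightarrow> z + x \<le> z + y"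
    by transfer (simp add: path_equiv_def path_le_add path_le_refl)
  show "0 \<le> x"
  proof transfer
    fix f :: "rat \<Rightarrow> 'a \<Rightarrow> 'b"
    show "(\<lambda>_ _. 0) \<lesssim> f" by (auto simp: path_le_def cu_prec_def zero_way_below)
  qed
qed

end

lemma path_equiv_refl: "is_path f \<Longrightarrow> path_equiv f f"
  by (simp add: path_equiv_def path_le_refl)

lemma ihom_cases:
  obtains f where "is_path f" "x = abs_ihom f"
proof -
  have "path_equiv (rep_ihom x) (rep_ihom x)" "abs_ihom (rep_ihom x) = x"
    using Quotient_ihom Quotient_rep_reflp Quotient_abs_rep by metis+
  then show ?thesis using that unfolding path_equiv_def by metis
qed

lemma ihom_le: "is_path f \<Longrightarrow> is_path g \<Longrightarrow> abs_ihom f \<le> abs_ihom g \<longleftrightarrow> f \<lesssim> g"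
  by (simp add: less_eq_ihom.abs_eq path_equiv_refl)

lemma ihom_plus:
  "is_path f \<Longrightarrow> is_path g \<Longrightarrow> abs_ihom f + abs_ihom g = abs_ihom (\<lambda>l a. f l a + g l a)"
  by (simp add: plus_ihom.abs_eq path_equiv_refl)

lemma path_seq_le:
  assumes "\<And>n. is_path (p n)" "\<And>n. p n \<lesssim> p (Suc n)" "i \<le> j" shows "p i \<lesssim> p j"
  using assms(3)
  by (induction rule: dec_induct) (auto intro: path_le_refl path_le_trans assms(1,2))

lemma path_sup:
  fixes p :: "nat \<Rightarrow> rat \<Rightarrow> 'a::cu_semigroup \<Rightarrow> 'b::cu_semigroup"
  assumes p: "\<And>n. is_path (p n)" and step: "\<And>n. p n \<lesssim> p (Suc n)"
  shows "\<exists>h. is_path h \<and> (\<forall>l\<in>IQ. \<exists>k. \<exists>m\<in>IQ. h l \<prec> p k m) \<and> (\<forall>k. p k \<lesssim> h)"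
proof -
  have dir: "\<exists>m\<in>IQ. p i s \<prec> p (max i j) m \<and> p j t \<prec> p (max i j) m"
    if st: "s \<in> IQ" "t \<in> IQ" for i j s t
  proof -
    have "p i \<lesssim> p (max i j)" "p j \<lesssim> p (max i j)" using path_seq_le[of p, OF p step] by simp_all
    then obtain m n where mn: "m \<in> IQ" "n \<in> IQ" "p i s \<prec> p (max i j) m" "p j t \<prec> p (max i j) n"
      using st unfolding path_le_def by blast
    have M: "max m n \<in> IQ" by (rule IQ_max[OF mn(1,2)])
    have "p i s \<prec> p (max i j) (max m n)"
      by (rule cu_prec_le_trans[OF mn(3) pathD(3)[OF p mn(1) M]]) simp
    moreover have "p j t \<prec> p (max i j) (max m n)"
      by (rule cu_prec_le_trans[OF mn(4) pathD(3)[OF p mn(2) M]]) simp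
    ultimately show ?thesis using M by blast
  qed
  obtain e :: "nat \<Rightarrow> nat \<times> rat" where e: "range e = UNIV \<times> IQ"
  proof -
    have "countable (UNIV \<times> IQ :: (nat \<times> rat) set)" by simp
    moreover have "(0, 1/2) \<in> (UNIV \<times> IQ :: (nat \<times> rat) set)" by (simp add: IQ_def)
    ultimately show ?thesis using that range_from_nat_into[of "UNIV \<times> IQ :: (nat \<times> rat) set"] by blast
  qed
  have eIQ: "snd (e n) \<in> IQ" for n using e by (metis SigmaE rangeI snd_conv)
  define R where "R n s s' \<longleftrightarrow> (\<exists>m\<in>IQ. m < snd s' \<and>
      p (fst s) (snd s) \<prec> p (fst s') m \<and> p (fst (e n)) (snd (e n)) \<prec> p (fst s') m)"
    for n :: nat and s s' :: "nat \<times> rat"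
  have "\<exists>S. \<forall>n. snd (S n) \<in> IQ \<and> R n (S n) (S (Suc n))"
  proof (rule dependent_nat_choice)
    show "\<exists>s::nat \<times> rat. snd s \<in> IQ" by (rule exI[of _ "(0, 1/2)"]) (simp add: IQ_def)
    fix s :: "nat \<times> rat" and n assume s: "snd s \<in> IQ"
    obtain m where m: "m \<in> IQ" "p (fst s) (snd s) \<prec> p (max (fst s) (fst (e n))) m"
      "p (fst (e n)) (snd (e n)) \<prec> p (max (fst s) (fst (e n))) m"
      using dir[OF s eIQ] by blast
    obtain m' where "m' \<in> IQ" "m < m'" using IQ_greater[OF m(1)] by blast
    then show "\<exists>s'. snd s' \<in> IQ \<and> R n s s'"
      using m unfolding R_def by (intro exI[of _ "(max (fst s) (fst (e n)), m')"]) auto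
  qed
  then obtain S where S: "\<And>n. snd (S n) \<in> IQ" "\<And>n. R n (S n) (S (Suc n))" by blast
  then obtain m where m: "\<And>n. m n \<in> IQ" "\<And>n. m n < snd (S (Suc n))"
    "\<And>n. p (fst (S n)) (snd (S n)) \<prec> p (fst (S (Suc n))) (m n)"
    "\<And>n. p (fst (e n)) (snd (e n)) \<prec> p (fst (S (Suc n))) (m n)"
    unfolding R_def by metis
  define x where "x n = p (fst (S n)) (snd (S n))" for n
  define w where "w n r = m n + (snd (S (Suc n)) - m n) * r" for n r
  define q where "q n r = p (fst (S (Suc n))) (w n r)" for n r
  have w_mono: "w n r < w n r'" if "r < r'" for n r r'
    using m(2)[of n] that by (simp add: w_def)
  have w0: "w n 0 = m n" and w1: "w n 1 = snd (S (Suc n))" for n by (simp_all add: w_def)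
  have wIQ: "w n r \<in> IQ" if "0 \<le> r" "r \<le> 1" for n r
  proof -
    have "m n \<le> w n r" "w n r \<le> snd (S (Suc n))"
      using w_mono[of 0 r n] w_mono[of r 1 n] that w0[of n] w1[of n] by (cases "r = 0"; cases "r = 1"; force)+
    then show ?thesis using m(1)[of n] S(1)[of "Suc n"] by (auto simp: IQ_def)
  qed
  have x_gen: "gen_cu_morphism (x n)" for n unfolding x_def by (rule pathD(1)[OF p S(1)])
  have q_gen: "gen_cu_morphism (q n r)" if "0 \<le> r" "r \<le> 1" for n r
    unfolding q_def by (rule pathD(1)[OF p wIQ[OF that]])
  have q_less: "q n r \<prec> q n r'" if "0 \<le> r" "r < r'" "r' \<le> 1" for n r r'
    unfolding q_def using that by (intro pathD(2)[OF p] wIQ w_mono) auto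
  have q1: "q n 1 = x (Suc n)" for n by (simp add: q_def x_def w1)
  have x_q0: "x n \<prec> q n 0" for n unfolding x_def q_def w0 by (rule m(3))
  have x_q: "x n \<prec> q n r" if "0 \<le> r" "r \<le> 1" for n r
  proof (cases "r = 0")
    case False
    then show ?thesis using that cu_prec_trans[OF x_q0 q_less q_gen q_gen, of r n] by simp
  qed (simp add: x_q0)
  have x_Suc: "x n \<prec> x (Suc n)" for n using x_q[of 1 n] q1 by simp
  have x_le: "x i a \<le> x j a" if "i \<le> j" for i j a
    using that by (induction rule: dec_induct) (auto intro: order_trans cu_prec_le[OF x_Suc x_gen x_gen])
  define T where "T l = 1 / (1 - l)" for l :: rat
  define N where "N l = nat (\<lfloor>T l\<rfloor> - 1)" for l
  define h where "h l = q (N l) (frac (T l))" for l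
  have T1: "1 < T l" if "l \<in> IQ" for l using that by (simp add: T_def IQ_def)
  have T_mono: "T l' < T l" if "l' \<in> IQ" "l \<in> IQ" "l' < l" for l l'
    using that by (simp add: T_def IQ_def frac_less2)
  have fr: "0 \<le> frac (T l)" "frac (T l) \<le> 1" "frac (T l) < 1" for l
    using frac_lt_1[of "T l"] by (simp_all add: less_imp_le)
  have h_path: "is_path h"
    unfolding is_path_def
  proof (intro conjI ballI impI)
    show "gen_cu_morphism (h l)" for l unfolding h_def by (rule q_gen[OF fr(1,2)])
    fix l' l assume l: "l' \<in> IQ" "l \<in> IQ" "l' < l"
    note T = T_mono[OF l]
    have fl: "\<lfloor>T l'\<rfloor> \<le> \<lfloor>T l\<rfloor>" "1 \<le> \<lfloor>T l'\<rfloor>" 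
      using floor_mono[OF less_imp_le[OF T]] T1[OF l(1)] by (simp_all add: le_floor_iff)
    show "h l' \<prec> h l"
    proof (cases "\<lfloor>T l'\<rfloor> = \<lfloor>T l\<rfloor>")
      case True
      then have "frac (T l') < frac (T l)" "N l' = N l" using T by (simp_all add: frac_def N_def)
      then show ?thesis unfolding h_def using q_less fr by simp
    next
      case False
      then have le: "Suc (N l') \<le> N l" using fl unfolding N_def by linarith
      have "h l' \<prec> x (Suc (N l'))" unfolding h_def q1[symmetric] by (rule q_less) (use fr in auto)
      then have "h l' \<prec> x (N l)" by (rule cu_prec_le_trans) (rule x_le[OF le])
      moreover have "x (N l) \<prec> h l" unfolding h_def by (rule x_q[OF fr(1,2)])
      ultimately show ?thesis
        by (rule cu_prec_trans) (simp_all add: x_gen h_def q_gen fr)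
    qed
  qed
  have "\<exists>k. \<exists>t\<in>IQ. h l \<prec> p k t" for l
  proof -
    have W: "w (N l) (frac (T l)) \<in> IQ" by (rule wIQ[OF fr(1,2)])
    obtain t where t: "t \<in> IQ" "w (N l) (frac (T l)) < t" using IQ_greater[OF W] by blast
    have "h l \<prec> p (fst (S (Suc (N l)))) t" unfolding h_def q_def by (rule pathD(2)[OF p W t])
    with t(1) show ?thesis by blast
  qed
  moreover have "p k \<lesssim> h" for k
    unfolding path_le_def
  proof
    fix t assume "t \<in> IQ"
    then have "(k, t) \<in> range e" using e by blast
    then obtain n where n: "e n = (k, t)" by (metis rangeE)
    define l :: rat where "l = 1 - 1 / (of_nat n + 3)"
    have l: "l \<in> IQ" by (simp add: l_def IQ_def)
    have T: "T l = of_nat (n + 3)" by (simp add: T_def l_def)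
    have Nl: "N l = n + 2" unfolding N_def T floor_of_nat by simp
    have "p k t \<prec> q n 0" using m(4)[of n] unfolding n q_def w0 by simp
    then have "p k t \<prec> x (Suc n)"
      unfolding q1[symmetric] by (rule cu_prec_trans[OF _ q_less q_gen q_gen]) simp_all
    then have "p k t \<prec> x (N l)" by (rule cu_prec_le_trans) (rule x_le, simp add: Nl)
    then have "p k t \<prec> h l"
      unfolding h_def by (rule cu_prec_trans[OF _ x_q x_gen q_gen]) (simp_all add: fr)
    with l show "\<exists>l\<in>IQ. p k t \<prec> h l" by blast
  qed
  ultimately show ?thesis using h_path by blast
qed

lemma ihom_increasing:
  fixes c :: "nat \<Rightarrow> ('a::cu_semigroup, 'b::cu_semigroup) ihom"
  assumes "increasing c"
  shows "\<exists>p h. (\<forall>n. is_path (p n) \<and> c n = abs_ihom (p n)) \<and> (\<forall>n. p n \<lesssim> p (Suc n)) \<and> is_path h \<and>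
    (\<forall>l\<in>IQ. \<exists>k. \<exists>m\<in>IQ. h l \<prec> p k m) \<and> is_lub (range c) (abs_ihom h)"
proof -
  have "\<exists>f. is_path f \<and> c n = abs_ihom f" for n using ihom_cases by metis
  then obtain p where p: "\<And>n. is_path (p n)" "\<And>n. c n = abs_ihom (p n)" by metis
  have step: "p n \<lesssim> p (Suc n)" for n
    using assms ihom_le[OF p(1) p(1)] unfolding increasing_def p(2) by blast
  obtain h where h: "is_path h" "\<And>l. l \<in> IQ \<Longrightarrow> \<exists>k. \<exists>m\<in>IQ. h l \<prec> p k m" "\<And>k. p k \<lesssim> h"
    using path_sup[of p, OF p(1) step] by blast
  have "abs_ihom h \<le> y" if y: "\<forall>a\<in>range c. a \<le> y" for y
  proof -
    obtain g where g: "is_path g" "y = abs_ihom g" by (rule ihom_cases)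
    have pg: "p k \<lesssim> g" for k using y ihom_le[OF p(1) g(1)] unfolding g(2) by (auto simp: p(2))
    have "h \<lesssim> g"
      unfolding path_le_def
    proof
      fix l assume "l \<in> IQ"
      then obtain k m where m: "m \<in> IQ" "h l \<prec> p k m" using h(2) by blast
      obtain n where n: "n \<in> IQ" "p k m \<prec> g n" using pg[of k] m(1) unfolding path_le_def by blast
      show "\<exists>n\<in>IQ. h l \<prec> g n"
        using cu_prec_trans[OF m(2) n(2) pathD(1)[OF p(1) m(1)] pathD(1)[OF g(1) n(1)]] n(1) by blast
    qed
    then show ?thesis by (simp add: ihom_le h(1) g)
  qed
  then have "is_lub (range c) (abs_ihom h)"
    unfolding is_lub_def using h(3) by (auto simp: p ihom_le h(1))
  with p step h(1,2) show ?thesis by (intro exI[of _ p] exI[of _ h]) simp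
qed

lemma path_scale:
  assumes "is_path f" "0 < r" "r < 1" shows "is_path (\<lambda>l. f (l * r))"
proof -
  have "l * r \<in> IQ" if "l \<in> IQ" for l
    using that assms(2,3) mult_strict_mono[of l 1 r 1] by (simp add: IQ_def)
  then show ?thesis
    using assms unfolding is_path_def by simp
qed

lemma ihom_approx:
  fixes f :: "rat \<Rightarrow> 'a::cu_semigroup \<Rightarrow> 'b::cu_semigroup"
  assumes f: "is_path f"
  defines "r \<equiv> \<lambda>n. 1 - 1 / (of_nat n + 2) :: rat"
  shows "r n \<in> IQ" "r n < r (Suc n)" "is_path (\<lambda>l. f (l * r n))"
    "increasing (\<lambda>n. abs_ihom (\<lambda>l. f (l * r n)))"
    "is_lub (range (\<lambda>n. abs_ihom (\<lambda>l. f (l * r n)))) (abs_ihom f)"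
proof -
  show r: "r n \<in> IQ" "r n < r (Suc n)" for n
    by (simp_all add: r_def IQ_def field_simps)
  then have path: "is_path (\<lambda>l. f (l * r n))" for n
    by (intro path_scale f) (auto simp: IQ_def)
  then show "is_path (\<lambda>l. f (l * r n))" .
  have lr: "l * t \<in> IQ" if "l \<in> IQ" "t \<in> IQ" for l t :: rat
    using that mult_strict_mono[of l 1 t 1] by (simp add: IQ_def)
  show "increasing (\<lambda>n. abs_ihom (\<lambda>l. f (l * r n)))"
    unfolding increasing_def
  proof (intro allI, subst ihom_le[OF path path])
    fix n
    have "f (l * r n) \<prec> f (l * r (Suc n))" if l: "l \<in> IQ" for l
      by (rule pathD(2)[OF f lr[OF l r(1)] lr[OF l r(1)]]) (use r(2) l in \<open>simp add: IQ_def\<close>)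
    then show "(\<lambda>l. f (l * r n)) \<lesssim> (\<lambda>l. f (l * r (Suc n)))" unfolding path_le_def by blast
  qed
  show "is_lub (range (\<lambda>n. abs_ihom (\<lambda>l. f (l * r n)))) (abs_ihom f)"
    unfolding is_lub_def
  proof (intro conjI ballI allI impI)
    fix x assume "x \<in> range (\<lambda>n. abs_ihom (\<lambda>l. f (l * r n)))"
    then obtain n where x: "x = abs_ihom (\<lambda>l. f (l * r n))" by blast
    have "f (l * r n) \<prec> f l" if l: "l \<in> IQ" for l
      by (rule pathD(2)[OF f lr[OF l r(1)] l]) (use r(1)[of n] l in \<open>simp add: IQ_def\<close>)
    then show "x \<le> abs_ihom f" unfolding x ihom_le[OF path f] path_le_def by blast
  next
    fix y assume y: "\<forall>x\<in>range (\<lambda>n. abs_ihom (\<lambda>l. f (l * r n))). x \<le> y"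
    obtain g where g: "is_path g" "y = abs_ihom g" by (rule ihom_cases)
    have le: "(\<lambda>l. f (l * r n)) \<lesssim> g" for n using y ihom_le[OF path g(1)] unfolding g(2) by blast
    have "\<exists>m\<in>IQ. f l \<prec> g m" if l: "l \<in> IQ" for l
    proof -
      obtain n where "1 / (1 - l) < of_nat n" using reals_Archimedean2 by blast
      then have n: "l < r n" using l by (simp add: r_def IQ_def field_simps)
      then have "l / r n \<in> IQ" using l r(1)[of n] by (simp add: IQ_def)
      then obtain m where "m \<in> IQ" "f (l / r n * r n) \<prec> g m"
        using le[of n] unfolding path_le_def by blast
      moreover have "l / r n * r n = l" using r(1)[of n] by (simp add: IQ_def)
      ultimately show ?thesis by auto
    qed
    then show "abs_ihom f \<le> y" unfolding g(2) ihom_le[OF f g(1)] path_le_def by blast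
  qed
qed

lemma ihom_way_below:
  assumes f: "is_path f" and g: "is_path g"
  shows "abs_ihom f \<lless> abs_ihom g \<longleftrightarrow> (\<exists>m\<in>IQ. \<forall>l\<in>IQ. f l \<prec> g m)"
proof
  assume fg: "abs_ihom f \<lless> abs_ihom g"
  note a = ihom_approx[OF g]
  let ?r = "\<lambda>n. 1 - 1 / (of_nat n + 2) :: rat"
  obtain n where "abs_ihom f \<le> abs_ihom (\<lambda>l. g (l * ?r n))"
    using way_belowD[OF fg a(4,5)] by blast
  then have le: "f \<lesssim> (\<lambda>l. g (l * ?r n))" using ihom_le[OF f a(3)] by blast
  have "f l \<prec> g (?r n)" if l: "l \<in> IQ" for l
  proof -
    obtain m where m: "m \<in> IQ" "f l \<prec> g (m * ?r n)" using le l unfolding path_le_def by blast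
    have lt: "m * ?r n < ?r n" "0 < m * ?r n" using m(1) a(1)[of n] by (simp_all add: IQ_def)
    have "?r n < 1" using a(1)[of n] unfolding IQ_def by (meson greaterThanLessThan_iff)
    with lt have mr: "m * ?r n \<in> IQ" unfolding IQ_def greaterThanLessThan_iff by (blast intro: less_trans)
    show ?thesis
      by (rule cu_prec_trans[OF m(2) pathD(2)[OF g mr a(1) lt(1)] pathD(1)[OF g mr] pathD(1)[OF g a(1)]])
  qed
  with a(1) show "\<exists>m\<in>IQ. \<forall>l\<in>IQ. f l \<prec> g m" by blast
next
  assume "\<exists>m\<in>IQ. \<forall>l\<in>IQ. f l \<prec> g m"
  then obtain m where m: "m \<in> IQ" "\<And>l. l \<in> IQ \<Longrightarrow> f l \<prec> g m" by blast
  show "abs_ihom f \<lless> abs_ihom g"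
    unfolding way_below_def
  proof (intro allI impI, elim conjE)
    fix c :: "nat \<Rightarrow> ('a, 'b) ihom" and s
    assume c: "increasing c" "is_lub (range c) s" "abs_ihom g \<le> s"
    obtain p h where ph: "\<And>n. is_path (p n)" "\<And>n. c n = abs_ihom (p n)" "is_path h"
      "\<And>l. l \<in> IQ \<Longrightarrow> \<exists>k. \<exists>m\<in>IQ. h l \<prec> p k m" "is_lub (range c) (abs_ihom h)"
      using ihom_increasing[OF c(1)] by blast
    have "s = abs_ihom h" by (rule is_lub_unique[OF c(2) ph(5)])
    then have "g \<lesssim> h" using c(3) ihom_le[OF g ph(3)] by simp
    then obtain l where l: "l \<in> IQ" "g m \<prec> h l" using m(1) unfolding path_le_def by blast
    obtain k n where n: "n \<in> IQ" "h l \<prec> p k n" using ph(4)[OF l(1)] by blast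
    have gp: "g m \<prec> p k n"
      by (rule cu_prec_trans[OF l(2) n(2) pathD(1)[OF ph(3) l(1)] pathD(1)[OF ph(1) n(1)]])
    have "f l \<prec> p k n" if "l \<in> IQ" for l
      by (rule cu_prec_trans[OF m(2)[OF that] gp pathD(1)[OF g m(1)] pathD(1)[OF ph(1) n(1)]])
    then have "f \<lesssim> p k" using n(1) unfolding path_le_def by blast
    then show "\<exists>k. abs_ihom f \<le> c k" using ihom_le[OF f ph(1)] unfolding ph(2) by blast
  qed
qed

instance ihom :: (cu_semigroup, cu_semigroup) cu_semigroup
proof
  fix a b a' b' :: "('a, 'b) ihom" and c d :: "nat \<Rightarrow> ('a, 'b) ihom"
  show "increasing c \<Longrightarrow> \<exists>s. is_lub (range c) s" using ihom_increasing by blast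
  show "\<exists>c. (\<forall>n. c n \<lless> c (Suc n)) \<and> is_lub (range c) a"
  proof -
    obtain f where f: "is_path f" "a = abs_ihom f" by (rule ihom_cases)
    let ?r = "\<lambda>n. 1 - 1 / (of_nat n + 2) :: rat"
    note ap = ihom_approx[OF f(1)]
    have "abs_ihom (\<lambda>l. f (l * ?r n)) \<lless> abs_ihom (\<lambda>l. f (l * ?r (Suc n)))" for n
    proof (subst ihom_way_below[OF ap(3) ap(3)], intro bexI ballI)
      have r: "0 < ?r n" "?r n < ?r (Suc n)" using ap(1)[of n] ap(2)[of n] by (simp_all add: IQ_def)
      then show "?r n / ?r (Suc n) \<in> IQ" by (simp add: IQ_def)
      have e: "?r n / ?r (Suc n) * ?r (Suc n) = ?r n" using r by simp
      fix l assume l: "l \<in> IQ"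
      have lt: "l * ?r n < ?r n" "0 < l * ?r n" using l r(1) by (simp_all add: IQ_def)
      have "?r n < 1" using ap(1)[of n] unfolding IQ_def by (meson greaterThanLessThan_iff)
      with lt have "l * ?r n \<in> IQ" unfolding IQ_def greaterThanLessThan_iff by (blast intro: less_trans)
      then show "f (l * ?r n) \<prec> f (?r n / ?r (Suc n) * ?r (Suc n))"
        unfolding e by (rule pathD(2)[OF f(1) _ ap(1) lt(1)])
    qed
    with ap(5) show ?thesis unfolding f(2) by (intro exI[of _ "\<lambda>n. abs_ihom (\<lambda>l. f (l * ?r n))"]) blast
  qed
  show "a' + b' \<lless> a + b" if ab: "a' \<lless> a" "b' \<lless> b"
  proof -
    obtain f where f: "is_path f" "a = abs_ihom f" by (rule ihom_cases)
    obtain g where g: "is_path g" "b = abs_ihom g" by (rule ihom_cases)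
    obtain f' where f': "is_path f'" "a' = abs_ihom f'" by (rule ihom_cases)
    obtain g' where g': "is_path g'" "b' = abs_ihom g'" by (rule ihom_cases)
    obtain m where m: "m \<in> IQ" "\<And>l. l \<in> IQ \<Longrightarrow> f' l \<prec> f m"
      using ab(1) ihom_way_below[OF f'(1) f(1)] unfolding f(2) f'(2) by blast
    obtain n where n: "n \<in> IQ" "\<And>l. l \<in> IQ \<Longrightarrow> g' l \<prec> g n"
      using ab(2) ihom_way_below[OF g'(1) g(1)] unfolding g(2) g'(2) by blast
    have M: "max m n \<in> IQ" by (rule IQ_max[OF m(1) n(1)])
    have "(\<lambda>a. f' l a + g' l a) \<prec> (\<lambda>a. f (max m n) a + g (max m n) a)" if l: "l \<in> IQ" for l
    proof (rule cu_prec_add)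
      show "f' l \<prec> f (max m n)"
        by (rule cu_prec_le_trans[OF m(2)[OF l] pathD(3)[OF f(1) m(1) M]]) simp
      show "g' l \<prec> g (max m n)"
        by (rule cu_prec_le_trans[OF n(2)[OF l] pathD(3)[OF g(1) n(1) M]]) simp
    qed
    then show ?thesis
      unfolding f(2) g(2) f'(2) g'(2) ihom_plus[OF f(1) g(1)] ihom_plus[OF f'(1) g'(1)]
        ihom_way_below[OF path_add[OF f'(1) g'(1)] path_add[OF f(1) g(1)]]
      using M by blast
  qed
  show "lub (range (\<lambda>n. c n + d n)) = lub (range c) + lub (range d)"
    if c: "increasing c" and d: "increasing d"
  proof -
    obtain p h where p: "\<And>n. is_path (p n)" "\<And>n. c n = abs_ihom (p n)" "\<And>n. p n \<lesssim> p (Suc n)"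
      "is_path h" "\<And>l. l \<in> IQ \<Longrightarrow> \<exists>k. \<exists>m\<in>IQ. h l \<prec> p k m" "is_lub (range c) (abs_ihom h)"
      using ihom_increasing[OF c] by blast
    obtain q h' where q: "\<And>n. is_path (q n)" "\<And>n. d n = abs_ihom (q n)" "\<And>n. q n \<lesssim> q (Suc n)"
      "is_path h'" "\<And>l. l \<in> IQ \<Longrightarrow> \<exists>k. \<exists>m\<in>IQ. h' l \<prec> q k m" "is_lub (range d) (abs_ihom h')"
      using ihom_increasing[OF d] by blast
    have "is_lub (range (\<lambda>n. c n + d n)) (abs_ihom h + abs_ihom h')"
      unfolding is_lub_def
    proof (intro conjI ballI allI impI)
      fix x assume "x \<in> range (\<lambda>n. c n + d n)"
      then show "x \<le> abs_ihom h + abs_ihom h'"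
        using is_lubD1[OF p(6)] is_lubD1[OF q(6)] by (auto intro: add_mono)
    next
      fix y assume y: "\<forall>x\<in>range (\<lambda>n. c n + d n). x \<le> y"
      obtain g where g: "is_path g" "y = abs_ihom g" by (rule ihom_cases)
      have le: "(\<lambda>l a. p n l a + q n l a) \<lesssim> g" for n
        using y ihom_le[OF path_add[OF p(1) q(1)] g(1)]
        by (auto simp: p(2) q(2) g(2) ihom_plus[OF p(1) q(1)])
      have "\<exists>m\<in>IQ. (\<lambda>a. h l a + h' l a) \<prec> g m" if l: "l \<in> IQ" for l
      proof -
        obtain i s where s: "s \<in> IQ" "h l \<prec> p i s" using p(5)[OF l] by blast
        obtain j t where t: "t \<in> IQ" "h' l \<prec> q j t" using q(5)[OF l] by blast
        define k where "k = max i j"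
        have "p i \<lesssim> p k" "q j \<lesssim> q k"
          using path_seq_le[of p, OF p(1,3)] path_seq_le[of q, OF q(1,3)] by (simp_all add: k_def)
        then obtain s' t' where s': "s' \<in> IQ" "p i s \<prec> p k s'" and t': "t' \<in> IQ" "q j t \<prec> q k t'"
          using s(1) t(1) unfolding path_le_def by meson
        have M: "max s' t' \<in> IQ" by (rule IQ_max[OF s'(1) t'(1)])
        have 1: "h l \<prec> p k (max s' t')"
        proof (rule cu_prec_le_trans)
          show "h l \<prec> p k s'"
            by (rule cu_prec_trans[OF s(2) s'(2) pathD(1)[OF p(1) s(1)] pathD(1)[OF p(1) s'(1)]])
          show "p k s' a \<le> p k (max s' t') a" for a by (rule pathD(3)[OF p(1) s'(1) M]) simp
        qed
        have 2: "h' l \<prec> q k (max s' t')"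
        proof (rule cu_prec_le_trans)
          show "h' l \<prec> q k t'"
            by (rule cu_prec_trans[OF t(2) t'(2) pathD(1)[OF q(1) t(1)] pathD(1)[OF q(1) t'(1)]])
          show "q k t' a \<le> q k (max s' t') a" for a by (rule pathD(3)[OF q(1) t'(1) M]) simp
        qed
        obtain m where m: "m \<in> IQ" "(\<lambda>a. p k (max s' t') a + q k (max s' t') a) \<prec> g m"
          using le[of k] M unfolding path_le_def by blast
        have "(\<lambda>a. h l a + h' l a) \<prec> g m"
          by (rule cu_prec_trans[OF cu_prec_add[OF 1 2] m(2) pathD(1)[OF path_add[OF p(1) q(1)] M]
                pathD(1)[OF g(1) m(1)]])
        with m(1) show ?thesis by blast
      qed
      then have "(\<lambda>l a. h l a + h' l a) \<lesssim> g" unfolding path_le_def by blast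
      then show "abs_ihom h + abs_ihom h' \<le> y"
        unfolding g(2) ihom_plus[OF p(4) q(4)] ihom_le[OF path_add[OF p(4) q(4)] g(1)] .
    qed
    then show ?thesis by (simp add: lub_eqI[OF p(6)] lub_eqI[OF q(6)] lub_eqI)
  qed
qed

lift_definition endpoint :: "('a::cu_semigroup, 'b::cu_semigroup) ihom \<Rightarrow> 'a \<Rightarrow> 'b"
  is "\<lambda>f a. lub ((\<lambda>l. f l a) ` IQ)"
proof
  fix f g :: "rat \<Rightarrow> 'a \<Rightarrow> 'b" and a
  assume fg: "path_equiv f g"
  have *: "\<forall>l\<in>IQ. f l a \<le> u" if "is_path f" "is_path g" "f \<lesssim> g" "\<forall>l\<in>IQ. g l a \<le> u"
    for f g :: "rat \<Rightarrow> 'a \<Rightarrow> 'b" and u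
  proof
    fix l assume l: "l \<in> IQ"
    then obtain m where m: "m \<in> IQ" "f l \<prec> g m" using \<open>f \<lesssim> g\<close> unfolding path_le_def by blast
    have "f l a \<le> g m a" by (rule cu_prec_le[OF m(2) pathD(1)[OF that(1) l] pathD(1)[OF that(2) m(1)]])
    also have "g m a \<le> u" using that(4) m(1) by blast
    finally show "f l a \<le> u" .
  qed
  have "(\<forall>l\<in>IQ. f l a \<le> u) \<longleftrightarrow> (\<forall>l\<in>IQ. g l a \<le> u)" for u
    using fg *[of f g u] *[of g f u] unfolding path_equiv_def by blast
  then have "is_lub ((\<lambda>l. f l a) ` IQ) = is_lub ((\<lambda>l. g l a) ` IQ)"
    unfolding is_lub_def fun_eq_iff by simp
  then show "lub ((\<lambda>l. f l a) ` IQ) = lub ((\<lambda>l. g l a) ` IQ)"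
    unfolding lub_def by simp
qed


subsection \<open>The bijection between morphisms and the products on internal homs\<close>

definition tensor_lift ::
    "('a::cu_semigroup \<Rightarrow> 'b::cu_semigroup \<Rightarrow> 'c::cu_semigroup) \<Rightarrow> 'a \<otimes> 'b \<Rightarrow> 'c"
  where "tensor_lift f = (THE h. cu_morphism h \<and> (\<forall>a b. h (a \<otimes> b) = f a b))"

lemma tensor_lift:
  "cu_bimorphism f \<Longrightarrow> cu_morphism (tensor_lift f) \<and> (\<forall>a b. tensor_lift f (a \<otimes> b) = f a b)"
  unfolding tensor_lift_def by (rule theI'[OF tensor_universal])

text \<open>Only used for Cu-morphisms \<open>f\<close> and \<open>g\<close>.\<close>

definition tensor_map ::
    "('a::cu_semigroup \<Rightarrow> 'c::cu_semigroup) \<Rightarrow> ('b::cu_semigroup \<Rightarrow> 'd::cu_semigroup)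
      \<Rightarrow> 'a \<otimes> 'b \<Rightarrow> 'c \<otimes> 'd"
  where "tensor_map f g = tensor_lift (\<lambda>a b. f a \<otimes> g b)"

definition tensor_flip :: "'a::cu_semigroup \<otimes> 'b::cu_semigroup \<Rightarrow> 'b \<otimes> 'a"
  where "tensor_flip = tensor_lift (\<lambda>a b. b \<otimes> a)"

definition tensor_assoc ::
    "('a::cu_semigroup \<otimes> 'b::cu_semigroup) \<otimes> 'c::cu_semigroup \<Rightarrow> 'a \<otimes> ('b \<otimes> 'c)"
  where "tensor_assoc =
    (THE h. cu_morphism h \<and> (\<forall>a b c. h ((a \<otimes> b) \<otimes> c) = a \<otimes> (b \<otimes> c)))"

definition tensor_assoc_inv ::
    "'a::cu_semigroup \<otimes> ('b::cu_semigroup \<otimes> 'c::cu_semigroup) \<Rightarrow> ('a \<otimes> 'b) \<otimes> 'c"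
  where "tensor_assoc_inv =
    (THE h. cu_morphism h \<and> (\<forall>a b c. h (a \<otimes> (b \<otimes> c)) = (a \<otimes> b) \<otimes> c))"

text \<open>
  \<open>ihom_uncurry\<close> is the bijection \<open>Cu(S, [[T, P]]) \<rightarrow> Cu(S \<otimes> T, P)\<close>, which sends \<open>\<alpha>\<close> to
  \<open>a \<otimes> b \<mapsto> endpoint (\<alpha> a) b\<close>, and \<open>ihom_curry\<close> is its inverse.
\<close>

definition ihom_uncurry ::
    "('a::cu_semigroup \<Rightarrow> ('b::cu_semigroup, 'c::cu_semigroup) ihom) \<Rightarrow> 'a \<otimes> 'b \<Rightarrow> 'c"
  where "ihom_uncurry \<alpha> = tensor_lift (\<lambda>a b. endpoint (\<alpha> a) b)"

definition ihom_curry ::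
    "('a::cu_semigroup \<otimes> 'b::cu_semigroup \<Rightarrow> 'c::cu_semigroup) \<Rightarrow> 'a \<Rightarrow> ('b, 'c) ihom"
  where "ihom_curry \<beta> = (THE \<alpha>. cu_morphism \<alpha> \<and> ihom_uncurry \<alpha> = \<beta>)"

definition eval_map :: "('a::cu_semigroup, 'b::cu_semigroup) ihom \<otimes> 'a \<Rightarrow> 'b"
  where "eval_map = ihom_uncurry id"

definition comp_map ::
    "('b::cu_semigroup, 'c::cu_semigroup) ihom \<otimes> ('a::cu_semigroup, 'b) ihom \<Rightarrow> ('a, 'c) ihom"
  where "comp_map = ihom_curry (eval_map \<circ> tensor_map id eval_map \<circ> tensor_assoc)"

definition comp_product ::
    "('b::cu_semigroup, 'c::cu_semigroup) ihom \<Rightarrow> ('a::cu_semigroup, 'b) ihom \<Rightarrow> ('a, 'c) ihom"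
    (infixr "\<odot>" 75)
  where "y \<odot> x = comp_map (y \<otimes> x)"

text \<open>
  The map \<open>id \<otimes> \<sigma> \<otimes> id\<close> that exchanges the two middle factors; the associativity isomorphisms
  around it are explicit.
\<close>

definition middle_flip ::
    "('a::cu_semigroup \<otimes> 'b::cu_semigroup) \<otimes> ('c::cu_semigroup \<otimes> 'd::cu_semigroup)
      \<Rightarrow> ('a \<otimes> 'c) \<otimes> ('b \<otimes> 'd)"
  where "middle_flip =
    tensor_assoc \<circ> tensor_map tensor_assoc_inv id \<circ>
    tensor_map (tensor_map id tensor_flip) id \<circ>
    tensor_map tensor_assoc id \<circ> tensor_assoc_inv"

definition ext_map ::
    "('a::cu_semigroup, 'b::cu_semigroup) ihom \<otimes> ('c::cu_semigroup, 'd::cu_semigroup) ihom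
      \<Rightarrow> ('a \<otimes> 'c, 'b \<otimes> 'd) ihom"
  where "ext_map = ihom_curry (tensor_map eval_map eval_map \<circ> middle_flip)"

definition ext_product ::
    "('a::cu_semigroup, 'b::cu_semigroup) ihom \<Rightarrow> ('c::cu_semigroup, 'd::cu_semigroup) ihom
      \<Rightarrow> ('a \<otimes> 'c, 'b \<otimes> 'd) ihom"  (infixr "\<boxtimes>" 75)
  where "x \<boxtimes> y = ext_map (x \<otimes> y)"

end

theory Submission
  imports Defs
begin

text \<open>
  Both sides are values at the same elementary tensor of two Cu-morphisms from
  \<open>([[T\<^sub>2, P\<^sub>2]] \<otimes> [[T\<^sub>1, P\<^sub>1]]) \<otimes> ([[S\<^sub>2, T\<^sub>2]] \<otimes> [[S\<^sub>1, T\<^sub>1]])\<close> to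
  \<open>[[S\<^sub>2 \<otimes> S\<^sub>1, P\<^sub>2 \<otimes> P\<^sub>1]]\<close>. A Cu-morphism into an internal hom is determined by the endpoints of
  its values, and on elementary tensors both endpoints send \<open>a \<otimes> b\<close> to
  \<open>endpoint y\<^sub>2 (endpoint x\<^sub>2 a) \<otimes> endpoint y\<^sub>1 (endpoint x\<^sub>1 b)\<close>.
  This needs the surjectivity of currying, which is proved for maps on a triple tensor product:
  a trimorphism \<open>f\<close> yields the path \<open>f (u\<^sub>\<lambda>) (v\<^sub>\<lambda>)\<close>, where \<open>u\<close> and \<open>v\<close> are \<open>\<lless>\<close>-increasing chains
  indexed by the rationals in \<open>(0, 1)\<close> with suprema \<open>a\<close> and \<open>b\<close>. The same construction gives the associativity
  isomorphism, to which the universal property does not apply directly: for fixed \<open>c\<close> the map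
  \<open>(a, b) \<mapsto> a \<otimes> (b \<otimes> c)\<close> need not preserve \<open>\<lless>\<close>.
\<close>

subsection \<open>Morphisms and bimorphisms\<close>

lemma lub_singleton: "lub {a} = a" for a :: "'a::order"
  by (rule lub_eqI) (simp add: is_lub_def)

lemma increasing_const: "increasing (\<lambda>_. a)" for a :: "'a::order"
  by (simp add: increasing_def)

lemma is_lub_mono:
  "is_lub A s \<Longrightarrow> (\<And>a. a \<in> A \<Longrightarrow> a \<le> t) \<Longrightarrow> s \<le> t" for s :: "'a::order"
  by (auto simp: is_lub_def)

lemma cu_morphismD:
  assumes "cu_morphism f"
  shows "f (a + b) = f a + f b" "f 0 = 0" "a \<le> b \<Longrightarrow> f a \<le> f b"
    "increasing c \<Longrightarrow> increasing (\<lambda>n. f (c n))"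
    "increasing c \<Longrightarrow> f (lub (range c)) = lub (range (\<lambda>n. f (c n)))"
    "a \<lless> b \<Longrightarrow> f a \<lless> f b"
  using assms gen_cu_morphismD[OF cu_morphism_gen[OF assms]] by (auto simp: cu_morphism_def)

lemma cu_morphism_id: "cu_morphism id"
  by (simp add: cu_morphism_def gen_cu_morphism_def mono_def)

lemma cu_bimorphismI:
  assumes "\<And>a a' b. f (a + a') b = f a b + f a' b" "\<And>a b b'. f a (b + b') = f a b + f a b'"
    "\<And>b. f 0 b = 0" "\<And>a. f a 0 = 0"
    "\<And>a a' b b'. a \<le> a' \<Longrightarrow> b \<le> b' \<Longrightarrow> f a b \<le> f a' b'"
    "\<And>c d. increasing c \<Longrightarrow> increasing d \<Longrightarrow>
      lub (range (\<lambda>n. f (c n) (d n))) = f (lub (range c)) (lub (range d))"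
    "\<And>a' a b' b. a' \<lless> a \<Longrightarrow> b' \<lless> b \<Longrightarrow> f a' b' \<lless> f a b"
  shows "cu_bimorphism f"
  unfolding cu_bimorphism_def mono_def
  using assms(6) by (simp add: assms(1-5,7))

lemma cu_bimorphism_increasing:
  "cu_bimorphism f \<Longrightarrow> increasing c \<Longrightarrow> increasing d \<Longrightarrow> increasing (\<lambda>n. f (c n) (d n))"
  using cu_bimorphismD(5)[of f] by (simp add: increasing_def)

lemma cu_bimorphism_comp:
  assumes f: "cu_bimorphism f" and g: "cu_morphism g" and h: "cu_morphism h"
  shows "cu_bimorphism (\<lambda>a b. f (g a) (h b))"
proof -
  have "lub (range (\<lambda>n. f (g (c n)) (h (d n)))) = f (g (lub (range c))) (h (lub (range d)))"
    if "increasing c" "increasing d" for c d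
    unfolding cu_morphismD(5)[OF g that(1)] cu_morphismD(5)[OF h that(2)]
    by (rule cu_bimorphismD(6)[OF f cu_morphismD(4)[OF g that(1)] cu_morphismD(4)[OF h that(2)]])
  then show ?thesis
    unfolding cu_bimorphism_def mono_def
    by (simp add: cu_bimorphismD(1-5,7)[OF f] cu_morphismD(1-3,6)[OF g] cu_morphismD(1-3,6)[OF h])
qed

lemma gen_cu_morphism_comp:
  assumes f: "gen_cu_morphism f" and g: "gen_cu_morphism g"
  shows "gen_cu_morphism (\<lambda>a. f (g a))"
proof -
  have "f (g (lub (range c))) = lub (range (\<lambda>n. f (g (c n))))" if "increasing c" for c
    unfolding gen_cu_morphismD(6)[OF g that]
    by (rule gen_cu_morphismD(6)[OF f gen_cu_morphismD(5)[OF g that]])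
  then show ?thesis
    unfolding gen_cu_morphism_def mono_def
    by (simp add: gen_cu_morphismD(1,2,4)[OF f] gen_cu_morphismD(1,2,4)[OF g])
qed

lemma cu_morphism_comp:
  assumes f: "cu_morphism f" and g: "cu_morphism g"
  shows "cu_morphism (f \<circ> g)"
  using gen_cu_morphism_comp[OF f[THEN cu_morphism_gen] g[THEN cu_morphism_gen]]
  by (simp add: cu_morphism_def comp_def cu_morphismD(6)[OF f] cu_morphismD(6)[OF g])

lemma cu_bimorphism_flip: "cu_bimorphism f \<Longrightarrow> cu_bimorphism (\<lambda>a b. f b a)"
  unfolding cu_bimorphism_def by blast

lemma cu_morphism_bimorphism:
  assumes f: "cu_morphism f" and g: "cu_bimorphism g"
  shows "cu_bimorphism (\<lambda>a b. f (g a b))"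
proof -
  have "lub (range (\<lambda>n. f (g (c n) (d n)))) = f (g (lub (range c)) (lub (range d)))"
    if "increasing c" "increasing d" for c d
    using cu_morphismD(5)[OF f cu_bimorphism_increasing[OF g that]] cu_bimorphismD(6)[OF g that] by simp
  then show ?thesis
    unfolding cu_bimorphism_def mono_def
    by (simp add: cu_bimorphismD(1-5,7)[OF g] cu_morphismD(1-3,6)[OF f])
qed

lemma tensor_morphism_eq:
  assumes f: "gen_cu_morphism f" and g: "gen_cu_morphism g" and eq: "\<And>a b. f (a \<otimes> b) = g (a \<otimes> b)"
  shows "f x = g x"
  by (rule antisym[OF tensor_morphism_le[OF f g] tensor_morphism_le[OF g f]]) (simp_all add: eq)

text \<open>Joint preservation of suprema, applied with a constant sequence in one variable, gives
  preservation in the other. The partial maps may fail to preserve \<lless>, since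
  \<open>a \<lless> a\<close> need not hold, so they are only generalized morphisms.\<close>

lemma gen_cu_morphism_bimorphism:
  assumes "cu_bimorphism f" shows "gen_cu_morphism (f a)" "gen_cu_morphism (\<lambda>a. f a b)"
proof -
  \<comment> \<open>Stated for fresh types, so that it also applies to the flipped
    bimorphism.\<close>
  have *: "gen_cu_morphism (f a)" if f: "cu_bimorphism f" for f :: "'x::cu_semigroup \<Rightarrow> 'y::cu_semigroup \<Rightarrow> 'z::cu_semigroup" and a
    unfolding gen_cu_morphism_def mono_def
    using cu_bimorphismD(6)[OF f increasing_const[of a]]
    by (auto simp: cu_bimorphismD(1-5)[OF f] lub_singleton)
  show "gen_cu_morphism (f a)" "gen_cu_morphism (\<lambda>a. f a b)"
    using *[OF assms] *[OF cu_bimorphism_flip[OF assms]] by blast+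
qed

subsection \<open>The endpoint map\<close>

lemma endpoint_abs_ihom:
  "is_path f \<Longrightarrow> endpoint (abs_ihom f) a = lub ((\<lambda>l. f l a) ` IQ)"
  by (simp add: endpoint.abs_eq path_equiv_refl)

lemma IQ_half: "1/2 \<in> IQ"
  by (simp add: IQ_def)

text \<open>The points \<open>r n\<close> are cofinal in \<open>IQ\<close>, so the supremum over the
  rational index set becomes that of an increasing sequence. This gives its existence by O1 and
  makes O4 applicable.\<close>

lemma endpoint_is_lub:
  assumes f: "is_path f"
  defines "r \<equiv> \<lambda>n. 1 - 1 / (of_nat n + 2) :: rat"
  shows "increasing (\<lambda>n. f (r n) a)"
    "is_lub (range (\<lambda>n. f (r n) a)) (endpoint (abs_ihom f) a)"
    "is_lub ((\<lambda>l. f l a) ` IQ) (endpoint (abs_ihom f) a)"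
proof -
  have r: "r n \<in> IQ" "r n < r (Suc n)" for n
    unfolding r_def by (rule ihom_approx(1,2)[OF f])+
  have up: "\<exists>n. f l a \<le> f (r n) a" if l: "l \<in> IQ" for l
  proof -
    obtain n where "1 / (1 - l) < of_nat n" using reals_Archimedean2 by blast
    then have "l < r n" using l by (simp add: r_def IQ_def field_simps)
    from pathD(3)[OF f l r(1) less_imp_le[OF this]] show ?thesis by blast
  qed
  show i: "increasing (\<lambda>n. f (r n) a)"
    unfolding increasing_def using r by (intro allI pathD(3)[OF f] less_imp_le)
  have "is_lub ((\<lambda>l. f l a) ` IQ) (lub (range (\<lambda>n. f (r n) a)))"
    unfolding is_lub_def using up r(1) order_trans[OF _ lub_upper[OF i]]
    by (auto intro!: lub_least[OF i])
  moreover from this have "endpoint (abs_ihom f) a = lub (range (\<lambda>n. f (r n) a))"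
    by (simp add: endpoint_abs_ihom[OF f] lub_eqI)
  ultimately show "is_lub ((\<lambda>l. f l a) ` IQ) (endpoint (abs_ihom f) a)"
    "is_lub (range (\<lambda>n. f (r n) a)) (endpoint (abs_ihom f) a)"
    using is_lub_lub[OF i] by simp_all
qed

lemma endpoint_upper: "is_path f \<Longrightarrow> l \<in> IQ \<Longrightarrow> f l a \<le> endpoint (abs_ihom f) a"
  using endpoint_is_lub(3)[of f a] by (auto simp: is_lub_def)

lemma endpoint_least:
  "is_path f \<Longrightarrow> (\<And>l. l \<in> IQ \<Longrightarrow> f l a \<le> u) \<Longrightarrow> endpoint (abs_ihom f) a \<le> u"
  using endpoint_is_lub(3)[of f a] by (auto simp: is_lub_def)

lemma endpoint_mono:
  assumes "x \<le> y" "a \<le> b" shows "endpoint x a \<le> endpoint y b"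
proof -
  obtain f where f: "is_path f" "x = abs_ihom f" by (rule ihom_cases)
  obtain g where g: "is_path g" "y = abs_ihom g" by (rule ihom_cases)
  have "f \<lesssim> g" using assms(1) f g ihom_le by blast
  show ?thesis unfolding f(2)
  proof (rule endpoint_least[OF f(1)])
    fix l assume l: "l \<in> IQ"
    then obtain m where m: "m \<in> IQ" "f l \<prec> g m" using \<open>f \<lesssim> g\<close> unfolding path_le_def by blast
    have "f l a \<le> g m a" by (rule cu_prec_le[OF m(2) pathD(1)[OF f(1) l] pathD(1)[OF g(1) m(1)]])
    also have "\<dots> \<le> g m b" by (rule gen_cu_morphismD(4)[OF pathD(1)[OF g(1) m(1)] assms(2)])
    also have "\<dots> \<le> endpoint y b" unfolding g(2) by (rule endpoint_upper[OF g(1) m(1)])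
    finally show "f l a \<le> endpoint y b" .
  qed
qed

lemma gen_cu_morphism_endpoint: "gen_cu_morphism (endpoint x)"
proof -
  obtain f where f: "is_path f" "x = abs_ihom f" by (rule ihom_cases)
  note r = ihom_approx(1)[OF f(1)]
  note seq = endpoint_is_lub(1,2)[OF f(1), folded f(2)]
  note gen = pathD(1)[OF f(1)]
  have 0: "endpoint x 0 = 0"
    by (intro antisym) (auto simp: f(2) zero_least gen_cu_morphismD(2)[OF gen] intro!: endpoint_least f(1))
  have sup: "endpoint x (lub (range c)) = lub (range (\<lambda>n. endpoint x (c n)))" if c: "increasing c" for c
  proof (rule antisym)
    have i: "increasing (\<lambda>n. endpoint x (c n))" using c by (auto simp: increasing_def intro: endpoint_mono)
    show "lub (range (\<lambda>n. endpoint x (c n))) \<le> endpoint x (lub (range c))"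
      by (intro lub_least[OF i] endpoint_mono order_refl lub_upper c)
    show "endpoint x (lub (range c)) \<le> lub (range (\<lambda>n. endpoint x (c n)))"
      unfolding f(2)
    proof (rule endpoint_least[OF f(1)])
      fix l assume l: "l \<in> IQ"
      have "f l (c n) \<le> lub (range (\<lambda>n. endpoint x (c n)))" for n
        using endpoint_upper[OF f(1) l, of "c n"] lub_upper[OF i, of n] f(2) by simp
      then show "f l (lub (range c)) \<le> lub (range (\<lambda>n. endpoint (abs_ihom f) (c n)))"
        unfolding gen_cu_morphismD(6)[OF gen[OF l] c] f(2)[symmetric]
        by (intro lub_least gen_cu_morphismD(5)[OF gen[OF l] c])
    qed
  qed
  have add: "endpoint x (a + b) = endpoint x a + endpoint x b" for a b
  proof (rule antisym)
    show "endpoint x (a + b) \<le> endpoint x a + endpoint x b"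
      unfolding f(2)
      by (rule endpoint_least[OF f(1)])
        (auto simp: gen_cu_morphismD(1)[OF gen] intro: add_mono endpoint_upper f(1))
    \<comment> \<open>O4 along a common sequence of indices tending to 1: the sum of the two suprema
      is the supremum of the sums, and each member of the path is additive.\<close>
    show "endpoint x a + endpoint x b \<le> endpoint x (a + b)"
      by (rule is_lub_mono[OF is_lub_add[OF seq(1) seq(1) seq(2) seq(2)]])
        (auto simp: gen_cu_morphismD(1)[OF gen[OF r], symmetric] f(2) intro: endpoint_upper[OF f(1) r])
  qed
  show ?thesis
    unfolding gen_cu_morphism_def mono_def using 0 sup add by (auto intro: endpoint_mono)
qed


text \<open>This makes \<open>ihom_uncurry\<close> an instance of the universal property of the
  tensor product.\<close>

lemma cu_bimorphism_endpoint:
  "cu_bimorphism (endpoint :: ('a::cu_semigroup, 'b::cu_semigroup) ihom \<Rightarrow> 'a \<Rightarrow> 'b)"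
proof -
  note gen = gen_cu_morphismD[OF gen_cu_morphism_endpoint]
  have add: "endpoint (x + y) a = endpoint x a + endpoint y a" for x y :: "('a, 'b) ihom" and a
  proof -
    obtain f where f: "is_path f" "x = abs_ihom f" by (rule ihom_cases)
    obtain g where g: "is_path g" "y = abs_ihom g" by (rule ihom_cases)
    note l = endpoint_is_lub[OF f(1)] endpoint_is_lub[OF g(1)] endpoint_is_lub[OF path_add[OF f(1) g(1)]]
    show ?thesis
      unfolding f(2) g(2) ihom_plus[OF f(1) g(1)]
      by (rule is_lub_unique[OF l(8) is_lub_add[OF l(1,4,2,5)]])
  qed
  have zero: "endpoint 0 a = 0" for a :: 'a
  proof (rule antisym)
    show "endpoint 0 a \<le> 0" unfolding zero_ihom_def by (rule endpoint_least[OF path_zero]) simp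
  qed (rule zero_least)
  have ll: "endpoint x' a' \<lless> endpoint x a"
    if ab: "x' \<lless> x" "a' \<lless> a" for x' x :: "('a, 'b) ihom" and a' a
  proof -
    obtain f where f: "is_path f" "x' = abs_ihom f" by (rule ihom_cases)
    obtain g where g: "is_path g" "x = abs_ihom g" by (rule ihom_cases)
    obtain m where m: "m \<in> IQ" "\<forall>l\<in>IQ. f l \<prec> g m"
      using ab(1)[unfolded f(2) g(2) ihom_way_below[OF f(1) g(1)]] by blast
    \<comment> \<open>A second index is taken because \<open>g m\<close> alone need not preserve
      \<lless>; the relation \<open>g m \<prec> g n\<close> carries \<open>a' \<lless> a\<close> to
      the target.\<close>
    obtain n where n: "n \<in> IQ" "m < n" using IQ_greater[OF m(1)] by blast
    have "endpoint x' a' \<le> g m a'"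
      unfolding f(2)
      by (rule endpoint_least[OF f(1)]) (rule cu_prec_le[OF bspec[OF m(2)] pathD(1)[OF f(1)] pathD(1)[OF g(1) m(1)]])
    also have "g m a' \<lless> g n a"
      using pathD(2)[OF g(1) m(1) n] ab(2) unfolding cu_prec_def by blast
    finally (le_way_below) show ?thesis
      unfolding g(2) by (rule way_below_trans_le) (rule endpoint_upper[OF g(1) n(1)])
  qed
  have sup: "lub (range (\<lambda>n. endpoint (c n) (d n))) = endpoint (lub (range c)) (lub (range d))"
    if c: "increasing c" and d: "increasing d" for c :: "nat \<Rightarrow> ('a, 'b) ihom" and d
  proof (rule antisym)
    have i: "increasing (\<lambda>n. endpoint (c n) (d n))"
      using c d by (simp add: increasing_def endpoint_mono)
    show "lub (range (\<lambda>n. endpoint (c n) (d n))) \<le> endpoint (lub (range c)) (lub (range d))"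
      by (rule lub_least[OF i]) (rule endpoint_mono[OF lub_upper[OF c] lub_upper[OF d]])
    \<comment> \<open>The supremum of \<open>c\<close> is represented by a path \<open>h\<close>
      each of whose members lies below a member of some \<open>p k\<close>. The indices
      \<open>k\<close> and \<open>n\<close> are then merged by \<open>max\<close>.\<close>
    obtain p h where p: "\<And>n. is_path (p n)" "\<And>n. c n = abs_ihom (p n)"
      "is_path h" "\<And>l. l \<in> IQ \<Longrightarrow> \<exists>k. \<exists>m\<in>IQ. h l \<prec> p k m" "is_lub (range c) (abs_ihom h)"
      using ihom_increasing[OF c] by blast
    show "endpoint (lub (range c)) (lub (range d)) \<le> lub (range (\<lambda>n. endpoint (c n) (d n)))"
      unfolding lub_eqI[OF p(5)]
    proof (rule endpoint_least[OF p(3)])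
      fix l assume l: "l \<in> IQ"
      obtain k m where m: "m \<in> IQ" "h l \<prec> p k m" using p(4)[OF l] by blast
      have "h l (d n) \<le> lub (range (\<lambda>n. endpoint (c n) (d n)))" for n
      proof -
        have "h l (d n) \<le> p k m (d n)"
          by (rule cu_prec_le[OF m(2) pathD(1)[OF p(3) l] pathD(1)[OF p(1) m(1)]])
        also have "\<dots> \<le> endpoint (c k) (d n)" unfolding p(2) by (rule endpoint_upper[OF p(1) m(1)])
        also have "\<dots> \<le> endpoint (c (max k n)) (d (max k n))"
          by (rule endpoint_mono[OF increasing_le[OF c] increasing_le[OF d]]) simp_all
        also have "\<dots> \<le> lub (range (\<lambda>n. endpoint (c n) (d n)))" by (rule lub_upper[OF i])
        finally show ?thesis .
      qed
      then show "h l (lub (range d)) \<le> lub (range (\<lambda>n. endpoint (c n) (d n)))"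
        unfolding gen_cu_morphismD(6)[OF pathD(1)[OF p(3) l] d]
        by (rule lub_least[OF gen_cu_morphismD(5)[OF pathD(1)[OF p(3) l] d]])
    qed
  qed
  show ?thesis
    by (rule cu_bimorphismI[OF add gen(1) zero gen(2) endpoint_mono sup ll])
qed

subsection \<open>Rational chains\<close>

text \<open>Cofinality for \<lless> replaces the demand that \<open>a\<close> be the supremum; it is
  the form in which two chains are compared.\<close>

definition rat_chain :: "(rat \<Rightarrow> 'a::cu_semigroup) \<Rightarrow> 'a \<Rightarrow> bool"
  where "rat_chain u a \<longleftrightarrow> (\<forall>l\<in>IQ. \<forall>m\<in>IQ. l < m \<longrightarrow> u l \<lless> u m) \<and>
    (\<forall>l\<in>IQ. u l \<lless> a) \<and> (\<forall>b. b \<lless> a \<longrightarrow> (\<exists>l\<in>IQ. b \<lless> u l))"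

lemma rat_chainD:
  assumes "rat_chain u a"
  shows "l \<in> IQ \<Longrightarrow> m \<in> IQ \<Longrightarrow> l < m \<Longrightarrow> u l \<lless> u m" "l \<in> IQ \<Longrightarrow> u l \<lless> a"
    "b \<lless> a \<Longrightarrow> \<exists>l\<in>IQ. b \<lless> u l" "l \<in> IQ \<Longrightarrow> m \<in> IQ \<Longrightarrow> l \<le> m \<Longrightarrow> u l \<le> u m"
  using assms way_below_le[of "u l" "u m"] unfolding rat_chain_def by (auto simp: le_less)

text \<open>The elements \<lless> \<open>a\<close> are upward directed, even for \<lless>. Used to
  place a new value of a chain above finitely many earlier ones.\<close>

lemma way_below_finite:
  fixes a :: "'a::cu_semigroup"
  assumes "finite L" "\<And>x. x \<in> L \<Longrightarrow> x \<lless> a"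
  shows "\<exists>y. y \<lless> a \<and> (\<forall>x\<in>L. x \<lless> y)"
proof -
  obtain s where s: "increasing s" "\<And>n. s n \<lless> a" "\<And>x. x \<lless> a \<Longrightarrow> \<exists>n. x \<lless> s n"
    using O2_seq[of a] by blast
  have "\<exists>n. \<forall>x\<in>L. x \<lless> s n"
    using assms
  proof (induction L)
    case (insert x L)
    obtain m where m: "\<forall>x\<in>L. x \<lless> s m" using insert.IH insert.prems by auto
    obtain n where n: "x \<lless> s n" using s(3)[OF insert.prems[OF insertI1]] by blast
    have "s m \<le> s (max m n)" "s n \<le> s (max m n)" by (simp_all add: increasing_le[OF s(1)])
    then have "\<forall>y\<in>insert x L. y \<lless> s (max m n)"
      using m way_below_trans_le[OF n] by (auto intro: way_below_trans_le)
    then show ?case ..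
  qed simp
  then show ?thesis using s(2) by blast
qed

text \<open>
  The values are chosen along an enumeration of the rationals; the floor of \<open>1 / (1 - q)\<close> tells
  how much of a given \<open>\<lless>\<close>-increasing sequence the value at \<open>q\<close> has to dominate.
\<close>

lemma rat_chain_ex: "\<exists>u. rat_chain u a" for a :: "'a::cu_semigroup"
proof -
  obtain c where c: "increasing c" "\<And>n. c n \<lless> a" "\<And>b. b \<lless> a \<Longrightarrow> \<exists>n. b \<lless> c n"
    using O2_seq[of a] by blast
  define N :: "rat \<Rightarrow> nat" where "N q = nat \<lfloor>1 / (1 - q)\<rfloor>" for q
  have N: "N l \<le> N m" if "l \<in> IQ" "m \<in> IQ" "l < m" for l m
    unfolding N_def using that by (intro nat_mono floor_mono) (simp add: IQ_def frac_le)
  define e where "e = from_nat_into IQ"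
  have "infinite IQ" unfolding IQ_def by (rule infinite_Ioo) simp
  then have "bij_betw e UNIV IQ" unfolding e_def by (intro bij_betw_from_nat_into) auto
  then have e: "e n \<in> IQ" "inj e" "range e = IQ" for n by (auto simp: bij_betw_def)
  \<comment> \<open>The invariant once the first \<open>n\<close> rationals have received their
    values.\<close>
  define P where "P n g \<longleftrightarrow> (\<forall>i<n. \<forall>j<n. e i < e j \<longrightarrow> g (e i) \<lless> g (e j)) \<and>
    (\<forall>i<n. g (e i) \<lless> a \<and> c (N (e i)) \<lless> g (e i))" for n :: nat and g :: "rat \<Rightarrow> 'a"
  have "\<exists>g. \<forall>n. P n (g n) \<and> (\<forall>i<n. g (Suc n) (e i) = g n (e i))"
  proof (rule dependent_nat_choice)
    show "\<exists>g. P 0 g" by (simp add: P_def)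
    fix g n assume g: "P n g"
    have g1: "g (e i) \<lless> g (e j)" if "i < n" "j < n" "e i < e j" for i j
      using g that unfolding P_def by blast
    have g2: "g (e i) \<lless> a" "c (N (e i)) \<lless> g (e i)" if "i < n" for i
      using g that unfolding P_def by blast+
    let ?L = "insert (c (N (e n))) (g ` e ` {i. i < n \<and> e i < e n})"
    let ?U = "e ` {i. i < n \<and> e n < e i}"
    \<comment> \<open>The barrier \<open>u\<close> from above is the value at the least treated
      rational beyond \<open>e n\<close>, or \<open>a\<close> if there is none. The new value
      \<open>y\<close> is then interpolated between \<open>?L\<close> and \<open>u\<close>.\<close>
    have "\<exists>u. (\<forall>x\<in>?L. x \<lless> u) \<and> u \<le> a \<and> (\<forall>q\<in>?U. u \<le> g q)"
    proof (cases "?U = {}")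
      case True
      then show ?thesis using g2(1) c(2) by (intro exI[of _ a]) blast
    next
      case False
      have fin: "finite ?U" by simp
      from Min_in[OF fin False] obtain k where k: "k < n" "e n < e k" "e k = Min ?U" by auto
      have "g (e k) \<le> g (e i)" if "i < n" "e n < e i" for i
      proof -
        have "e k \<le> e i" unfolding k(3) by (rule Min_le[OF fin]) (use that in blast)
        then have "e k = e i \<or> e k < e i" by auto
        then show ?thesis using way_below_le[OF g1[OF k(1) that(1)]] by auto
      qed
      moreover have "x \<lless> g (e k)" if x: "x \<in> ?L" for x
      proof (cases "x = c (N (e n))")
        case True
        have "c (N (e n)) \<le> c (N (e k))" using N[OF e(1) e(1) k(2)] by (rule increasing_le[OF c(1)])
        then show ?thesis unfolding True by (rule le_way_below[OF _ g2(2)[OF k(1)]])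
      next
        case False
        then obtain i where i: "i < n" "e i < e n" "x = g (e i)" using x by blast
        then have "e i < e k" using k(2) by simp
        then show ?thesis unfolding i(3) by (rule g1[OF i(1) k(1)])
      qed
      moreover have "g (e k) \<le> a" by (rule way_below_le[OF g2(1)[OF k(1)]])
      ultimately show ?thesis by blast
    qed
    then obtain u where "(\<forall>x\<in>?L. x \<lless> u) \<and> u \<le> a \<and> (\<forall>q\<in>?U. u \<le> g q)" ..
    then have u: "\<And>x. x \<in> ?L \<Longrightarrow> x \<lless> u" "u \<le> a" "\<And>q. q \<in> ?U \<Longrightarrow> u \<le> g q" by auto
    have "finite ?L" by simp
    from way_below_finite[OF this u(1)] obtain y where "y \<lless> u \<and> (\<forall>x\<in>?L. x \<lless> y)" ..
    then have y: "y \<lless> u" "\<And>x. x \<in> ?L \<Longrightarrow> x \<lless> y" by auto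
    have ne: "e i \<noteq> e n" if "i < n" for i using that e(2) by (auto dest: injD)
    let ?g = "g(e n := y)"
    have "?g (e i) \<lless> ?g (e j)" if ij: "i < Suc n" "j < Suc n" "e i < e j" for i j
    proof -
      consider "i < n" "j < n" | "i < n" "j = n" | "i = n" "j < n" using ij by (auto simp: less_Suc_eq)
      then show ?thesis
      proof cases
        case 1 then show ?thesis using ij(3) ne g1 by simp
      next
        case 2 then show ?thesis using ij(3) ne y(2)[of "g (e i)"] by simp
      next
        case 3 then show ?thesis using ij(3) ne way_below_trans_le[OF y(1) u(3)[of "e j"]] by simp
      qed
    qed
    moreover have "?g (e i) \<lless> a \<and> c (N (e i)) \<lless> ?g (e i)" if "i < Suc n" for i
      using that ne g2 y(2) way_below_trans_le[OF y(1) u(2)] by (auto simp: less_Suc_eq)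
    ultimately have "P (Suc n) ?g" unfolding P_def by blast
    then show "\<exists>g'. P (Suc n) g' \<and> (\<forall>i<n. g' (e i) = g (e i))"
      using ne by (intro exI[of _ ?g]) auto
  qed
  then obtain g where g: "\<And>n. P n (g n)" "\<And>n i. i < n \<Longrightarrow> g (Suc n) (e i) = g n (e i)" by blast
  \<comment> \<open>Stage \<open>Suc (inv e q)\<close> is the first whose invariant covers
    \<open>q\<close>; later stages keep the value.\<close>
  define u where "u q = g (Suc (inv e q)) q" for q
  have gu: "g n (e i) = u (e i)" if "i < n" for i n
  proof -
    have "Suc i \<le> n" using that by simp
    then show ?thesis by (induction rule: dec_induct) (auto simp: u_def e(2) g(2))
  qed
  have u: "u (e i) \<lless> u (e j)" if "e i < e j" for i j
  proof -
    have "g (Suc (max i j)) (e i) \<lless> g (Suc (max i j)) (e j)"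
      using g(1)[of "Suc (max i j)"] that unfolding P_def by (simp add: less_Suc_eq_le)
    then show ?thesis by (simp add: gu less_Suc_eq_le)
  qed
  have ua: "u (e i) \<lless> a" "c (N (e i)) \<lless> u (e i)" for i
    using g(1)[of "Suc i"] gu[of i "Suc i"] unfolding P_def by auto
  have "rat_chain u a"
    unfolding rat_chain_def
  proof (intro conjI ballI allI impI)
    show "u l \<lless> u m" if "l \<in> IQ" "m \<in> IQ" "l < m" for l m
      using that u unfolding e(3)[symmetric] by blast
    show "u l \<lless> a" if "l \<in> IQ" for l using that ua(1) unfolding e(3)[symmetric] by blast
    fix b assume "b \<lless> a"
    then obtain n where n: "b \<lless> c n" using c(3) by blast
    \<comment> \<open>Chosen so that \<open>1 / (1 - q)\<close> is the integer \<open>n + 2\<close>;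
      hence \<open>u q\<close> dominates \<open>c (n + 2)\<close> and with it
      \<open>c n\<close>.\<close>
    define q :: rat where "q = 1 - 1 / (of_nat n + 2)"
    have q: "q \<in> IQ" by (simp add: q_def IQ_def)
    have "1 / (1 - q) = of_nat (n + 2)" by (simp add: q_def)
    then have "N q = n + 2" unfolding N_def by (simp only: floor_of_nat nat_int)
    then have "c n \<le> c (N q)" by (intro increasing_le[OF c(1)]) simp
    moreover have "c (N q) \<lless> u q" using q ua(2) unfolding e(3)[symmetric] by blast
    ultimately show "\<exists>l\<in>IQ. b \<lless> u l"
      using n q way_below_trans_le way_below_trans by blast
  qed
  then show ?thesis by blast
qed

text \<open>Both chains increase, so the larger of two indices serves both. The common index matches
  the single parameter of the path \<open>f (u l) (v l)\<close>.\<close>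

lemma rat_chain_below:
  assumes u: "rat_chain u a" and v: "rat_chain v b" and ab: "a' \<lless> a" "b' \<lless> b"
  shows "\<exists>m\<in>IQ. a' \<lless> u m \<and> b' \<lless> v m"
proof -
  obtain l where l: "l \<in> IQ" "a' \<lless> u l" using rat_chainD(3)[OF u ab(1)] by blast
  obtain m where m: "m \<in> IQ" "b' \<lless> v m" using rat_chainD(3)[OF v ab(2)] by blast
  have M: "max l m \<in> IQ" by (rule IQ_max[OF l(1) m(1)])
  have "a' \<lless> u (max l m)"
    by (rule way_below_trans_le[OF l(2) rat_chainD(4)[OF u l(1) M]]) simp
  moreover have "b' \<lless> v (max l m)"
    by (rule way_below_trans_le[OF m(2) rat_chainD(4)[OF v m(1) M]]) simp
  ultimately show ?thesis using M by blast
qed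

lemma rat_chain_add:
  assumes u: "rat_chain u a" and v: "rat_chain v b"
  shows "rat_chain (\<lambda>l. u l + v l) (a + b)"
  unfolding rat_chain_def
proof (intro conjI ballI allI impI)
  show "u l + v l \<lless> u m + v m" if "l \<in> IQ" "m \<in> IQ" "l < m" for l m
    by (rule O3[OF rat_chainD(1)[OF u that] rat_chainD(1)[OF v that]])
  show "u l + v l \<lless> a + b" if "l \<in> IQ" for l
    by (rule O3[OF rat_chainD(2)[OF u that] rat_chainD(2)[OF v that]])
  fix c assume "c \<lless> a + b"
  then obtain a' b' where c: "a' \<lless> a" "b' \<lless> b" "c \<le> a' + b'" by (rule sum_below)
  obtain m where m: "m \<in> IQ" "a' \<lless> u m" "b' \<lless> v m"
    using rat_chain_below[OF u v c(1,2)] by blast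
  show "\<exists>l\<in>IQ. c \<lless> u l + v l"
    using m(1) le_way_below[OF c(3) O3[OF m(2,3)]] by blast
qed

lemma rat_chain_zero: "rat_chain (\<lambda>_. 0) 0"
  unfolding rat_chain_def using IQ_half zero_way_below by blast

subsection \<open>Currying of trimorphisms\<close>

locale cu_trimorphism =
  fixes f :: "'a::cu_semigroup \<Rightarrow> 'b::cu_semigroup \<Rightarrow> 'c::cu_semigroup \<Rightarrow> 'd::cu_semigroup"
  assumes add1: "f (a + a') b c = f a b c + f a' b c"
    and add2: "f a (b + b') c = f a b c + f a b' c"
    and add3: "f a b (c + c') = f a b c + f a b c'"
    and zero1: "f 0 b c = 0" and zero2: "f a 0 c = 0" and zero3: "f a b 0 = 0"
    and mono: "a \<le> a' \<Longrightarrow> b \<le> b' \<Longrightarrow> c \<le> c' \<Longrightarrow> f a b c \<le> f a' b' c'"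
    and sup: "increasing p \<Longrightarrow> increasing q \<Longrightarrow> increasing r \<Longrightarrow>
      lub (range (\<lambda>n. f (p n) (q n) (r n))) = f (lub (range p)) (lub (range q)) (lub (range r))"
    and way_below: "a' \<lless> a \<Longrightarrow> b' \<lless> b \<Longrightarrow> c' \<lless> c \<Longrightarrow> f a' b' c' \<lless> f a b c"

lemma cu_trimorphism_left:
  assumes f: "cu_bimorphism f" and g: "cu_bimorphism g"
  shows "cu_trimorphism (\<lambda>a b c. f (g a b) c)"
proof
  show "lub (range (\<lambda>n. f (g (p n) (q n)) (r n))) = f (g (lub (range p)) (lub (range q))) (lub (range r))"
    if "increasing p" "increasing q" "increasing r" for p q r
    using cu_bimorphismD(6)[OF f cu_bimorphism_increasing[OF g that(1,2)] that(3)]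
    unfolding cu_bimorphismD(6)[OF g that(1,2)] .
qed (simp_all add: cu_bimorphismD(1-5,7)[OF f] cu_bimorphismD(1-5,7)[OF g])

lemma cu_trimorphism_right:
  assumes f: "cu_bimorphism f" and g: "cu_bimorphism g"
  shows "cu_trimorphism (\<lambda>a b c. f a (g b c))"
proof
  show "lub (range (\<lambda>n. f (p n) (g (q n) (r n)))) = f (lub (range p)) (g (lub (range q)) (lub (range r)))"
    if "increasing p" "increasing q" "increasing r" for p q r
    using cu_bimorphismD(6)[OF f that(1) cu_bimorphism_increasing[OF g that(2,3)]]
    unfolding cu_bimorphismD(6)[OF g that(2,3)] .
qed (simp_all add: cu_bimorphismD(1-5,7)[OF f] cu_bimorphismD(1-5,7)[OF g])

text \<open>Currying splits off the last variable; the rotation puts the first one there, as the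
  inverse associativity map requires.\<close>

lemma cu_trimorphism_rotate:
  assumes "cu_trimorphism f" shows "cu_trimorphism (\<lambda>b c a. f a b c)"
proof -
  interpret cu_trimorphism f by (rule assms)
  show ?thesis
    by unfold_locales (simp_all add: add1 add2 add3 zero1 zero2 zero3 mono sup way_below)
qed

context cu_trimorphism
begin

lemma gen: "gen_cu_morphism (f a b)"
proof -
  have "f a b (lub (range r)) = lub (range (\<lambda>n. f a b (r n)))" if "increasing r" for r
    using sup[OF increasing_const[of a] increasing_const[of b] that]
    by (simp add: lub_singleton)
  then show ?thesis
    unfolding gen_cu_morphism_def mono_on_def by (simp add: add3 zero3 mono)
qed

lemma prec: "a' \<lless> a \<Longrightarrow> b' \<lless> b \<Longrightarrow> f a' b' \<prec> f a b"
  unfolding cu_prec_def using way_below by blast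

text \<open>Joint preservation of \<lless> turns the \<lless>-increase of the chains into \<prec>. A
  constant family would not do, as \<open>f a b \<prec> f a b\<close> can fail.\<close>

lemma path:
  assumes u: "rat_chain u a" and v: "rat_chain v b" shows "is_path (\<lambda>l. f (u l) (v l))"
  unfolding is_path_def
  using gen prec[OF rat_chainD(1)[OF u] rat_chainD(1)[OF v]]
  by blast

text \<open>From \<open>u l \<lless> a \<le> a'\<close> and likewise for \<open>v l\<close>, both
  members are absorbed by \<open>u'\<close> and \<open>v'\<close> at one index. For
  \<open>a = a'\<close> and \<open>b = b'\<close> this shows that the class does not depend on the
  chains.\<close>

lemma path_mono:
  assumes u: "rat_chain u a" and v: "rat_chain v b" and u': "rat_chain u' a'" and v': "rat_chain v' b'"
    and le: "a \<le> a'" "b \<le> b'"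
  shows "abs_ihom (\<lambda>l. f (u l) (v l)) \<le> abs_ihom (\<lambda>l. f (u' l) (v' l))"
  unfolding ihom_le[OF path[OF u v] path[OF u' v']] path_le_def
proof
  fix l assume l: "l \<in> IQ"
  have "u l \<lless> a'" "v l \<lless> b'"
    using way_below_trans_le[OF rat_chainD(2)[OF u l] le(1)]
      way_below_trans_le[OF rat_chainD(2)[OF v l] le(2)] by simp_all
  from rat_chain_below[OF u' v' this] obtain m
    where m: "m \<in> IQ" "u l \<lless> u' m" "v l \<lless> v' m" by blast
  show "\<exists>m\<in>IQ. f (u l) (v l) \<prec> f (u' m) (v' m)"
    using m(1) prec[OF m(2,3)] by blast
qed

text \<open>The chains are arbitrary choices, harmless by \<open>path_mono\<close>.\<close>

definition ihom_of :: "'a \<Rightarrow> 'b \<Rightarrow> ('c, 'd) ihom"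
  where "ihom_of a b =
    abs_ihom (\<lambda>l. f ((SOME u. rat_chain u a) l) ((SOME u. rat_chain u b) l))"

lemma ihom_of_eq:
  assumes "rat_chain u a" "rat_chain v b"
  shows "ihom_of a b = abs_ihom (\<lambda>l. f (u l) (v l))"
proof -
  have "rat_chain (SOME u. rat_chain u a) a" "rat_chain (SOME u. rat_chain u b) b"
    using someI_ex[OF rat_chain_ex] by blast+
  note c = assms this
  show ?thesis
    unfolding ihom_of_def
    by (intro antisym path_mono[OF c(3,4,1,2)] path_mono[OF c] order_refl)
qed

lemma ihom_of_mono:
  assumes "a \<le> a'" "b \<le> b'" shows "ihom_of a b \<le> ihom_of a' b'"
proof -
  obtain u v u' v' where c: "rat_chain u a" "rat_chain v b" "rat_chain u' a'" "rat_chain v' b'"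
    using rat_chain_ex by metis
  show ?thesis
    unfolding ihom_of_eq[OF c(1,2)] ihom_of_eq[OF c(3,4)]
    by (rule path_mono[OF c assms])
qed

text \<open>By \<open>ihom_of_eq\<close> each clause may be read off from convenient chains, such as
  pointwise sums for additivity and the constant chain for zero.\<close>

lemma cu_bimorphism_ihom_of: "cu_bimorphism ihom_of"
proof (rule cu_bimorphismI)
  note eq = ihom_of_eq
  show "ihom_of (a + a') b = ihom_of a b + ihom_of a' b" for a a' b
  proof -
    obtain u u' v where c: "rat_chain u a" "rat_chain u' a'" "rat_chain v b"
      using rat_chain_ex by metis
    show ?thesis
      unfolding eq[OF c(1,3)] eq[OF c(2,3)] eq[OF rat_chain_add[OF c(1,2)] c(3)]
        ihom_plus[OF path[OF c(1,3)] path[OF c(2,3)]]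
      by (rule arg_cong[where f = abs_ihom]) (simp add: fun_eq_iff add1)
  qed
  show "ihom_of a (b + b') = ihom_of a b + ihom_of a b'" for a b b'
  proof -
    obtain u v v' where c: "rat_chain u a" "rat_chain v b" "rat_chain v' b'"
      using rat_chain_ex by metis
    show ?thesis
      unfolding eq[OF c(1,2)] eq[OF c(1,3)] eq[OF c(1) rat_chain_add[OF c(2,3)]]
        ihom_plus[OF path[OF c(1,2)] path[OF c(1,3)]]
      by (rule arg_cong[where f = abs_ihom]) (simp add: fun_eq_iff add2)
  qed
  show "ihom_of 0 b = 0" for b
  proof -
    obtain v where v: "rat_chain v b" using rat_chain_ex by blast
    show ?thesis
      unfolding eq[OF rat_chain_zero v] zero_ihom_def
      by (rule arg_cong[where f = abs_ihom]) (simp add: fun_eq_iff zero1)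
  qed
  show "ihom_of a 0 = 0" for a
  proof -
    obtain u where u: "rat_chain u a" using rat_chain_ex by blast
    show ?thesis
      unfolding eq[OF u rat_chain_zero] zero_ihom_def
      by (rule arg_cong[where f = abs_ihom]) (simp add: fun_eq_iff zero2)
  qed
  show "ihom_of a b \<le> ihom_of a' b'" if "a \<le> a'" "b \<le> b'" for a a' b b'
    using that by (rule ihom_of_mono)
  show "ihom_of a' b' \<lless> ihom_of a b" if ab: "a' \<lless> a" "b' \<lless> b" for a a' b b'
  proof -
    obtain u v u' v' where c: "rat_chain u a" "rat_chain v b" "rat_chain u' a'" "rat_chain v' b'"
      using rat_chain_ex by metis
    obtain m where m: "m \<in> IQ" "a' \<lless> u m" "b' \<lless> v m"
      using rat_chain_below[OF c(1,2) ab] by blast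
    \<comment> \<open>The whole path for \<open>a'\<close> and \<open>b'\<close> stays below the
      single member at \<open>m\<close>, which is the criterion for \<lless> between
      classes.\<close>
    have "f (u' l) (v' l) \<prec> f (u m) (v m)" if "l \<in> IQ" for l
      using rat_chainD(2)[OF c(3) that] rat_chainD(2)[OF c(4) that] m(2,3)
      by (intro prec) (auto intro: way_below_trans)
    with m(1) show ?thesis
      unfolding eq[OF c(1,2)] eq[OF c(3,4)] ihom_way_below[OF path[OF c(3,4)] path[OF c(1,2)]]
      by blast
  qed
  fix p :: "nat \<Rightarrow> 'a" and q :: "nat \<Rightarrow> 'b" assume p: "increasing p" and q: "increasing q"
  obtain u v where c: "rat_chain u (lub (range p))" "rat_chain v (lub (range q))"
    using rat_chain_ex by metis
  show "lub (range (\<lambda>n. ihom_of (p n) (q n))) =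
    ihom_of (lub (range p)) (lub (range q))"
  proof (rule antisym)
    have i: "increasing (\<lambda>n. ihom_of (p n) (q n))"
      using p q by (simp add: increasing_def ihom_of_mono)
    show "lub (range (\<lambda>n. ihom_of (p n) (q n))) \<le>
      ihom_of (lub (range p)) (lub (range q))"
      by (rule lub_least[OF i]) (rule ihom_of_mono[OF lub_upper[OF p] lub_upper[OF q]])
    \<comment> \<open>With a path \<open>g\<close> for the supremum the claim is about \<prec>: each
      member is absorbed by the path for some \<open>p k\<close> and \<open>q k\<close>, and that
      path by \<open>g\<close>.\<close>
    obtain g where g: "is_path g" "lub (range (\<lambda>n. ihom_of (p n) (q n))) = abs_ihom g"
      by (rule ihom_cases)
    show "ihom_of (lub (range p)) (lub (range q)) \<le>
      lub (range (\<lambda>n. ihom_of (p n) (q n)))"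
      unfolding eq[OF c] g(2) ihom_le[OF path[OF c] g(1)] path_le_def
    proof
      fix l assume l: "l \<in> IQ"
      obtain i where i': "u l \<lless> p i" using le_interpolate_lub[OF rat_chainD(2)[OF c(1) l] p] by blast
      obtain j where j: "v l \<lless> q j" using le_interpolate_lub[OF rat_chainD(2)[OF c(2) l] q] by blast
      define k where "k = max i j"
      have uv: "u l \<lless> p k" "v l \<lless> q k"
        using way_below_trans_le[OF i' increasing_le[OF p, of i k]]
          way_below_trans_le[OF j increasing_le[OF q, of j k]] by (simp_all add: k_def)
      obtain u' v' where c': "rat_chain u' (p k)" "rat_chain v' (q k)"
        using rat_chain_ex by metis
      obtain m where m: "m \<in> IQ" "u l \<lless> u' m" "v l \<lless> v' m"
        using rat_chain_below[OF c' uv] by blast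
      have "abs_ihom (\<lambda>l. f (u' l) (v' l)) \<le> abs_ihom g"
        using lub_upper[OF i, of k] unfolding g(2) eq[OF c'] .
      then obtain n where n: "n \<in> IQ" "f (u' m) (v' m) \<prec> g n"
        using m(1) unfolding ihom_le[OF path[OF c'] g(1)] path_le_def by blast
      have "f (u l) (v l) \<prec> g n"
        by (rule cu_prec_trans[OF prec[OF m(2,3)] n(2) gen
              pathD(1)[OF g(1) n(1)]])
      with n(1) show "\<exists>n\<in>IQ. f (u l) (v l) \<prec> g n" by blast
    qed
  qed
qed

lemma endpoint_ihom_of: "endpoint (ihom_of a b) c = f a b c"
proof -
  obtain u v where uv: "rat_chain u a" "rat_chain v b" using rat_chain_ex by metis
  note path_uv = path[OF uv]
  show ?thesis
    unfolding ihom_of_eq[OF uv]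
  proof (rule antisym)
    show "endpoint (abs_ihom (\<lambda>l. f (u l) (v l))) c \<le> f a b c"
      by (rule endpoint_least[OF path_uv])
        (rule mono[OF way_below_le[OF rat_chainD(2)[OF uv(1)]]
            way_below_le[OF rat_chainD(2)[OF uv(2)]] order_refl])
    \<comment> \<open>Sequences stand in for the chains, since \<open>sup\<close> speaks of
      sequences; the third argument is kept constant.\<close>
    obtain p where p: "increasing p" "is_lub (range p) a" "\<And>n. p n \<lless> a" using O2_seq[of a] by blast
    obtain q where q: "increasing q" "is_lub (range q) b" "\<And>n. q n \<lless> b" using O2_seq[of b] by blast
    have le: "f (p n) (q n) c \<le> endpoint (abs_ihom (\<lambda>l. f (u l) (v l))) c" for n
    proof -
      obtain m where m: "m \<in> IQ" "p n \<lless> u m" "q n \<lless> v m"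
        using rat_chain_below[OF uv p(3) q(3)] by blast
      have "f (p n) (q n) c \<le> f (u m) (v m) c"
        by (rule mono[OF way_below_le[OF m(2)] way_below_le[OF m(3)] order_refl])
      also have "\<dots> \<le> endpoint (abs_ihom (\<lambda>l. f (u l) (v l))) c" by (rule endpoint_upper[OF path_uv m(1)])
      finally show ?thesis .
    qed
    have i: "increasing (\<lambda>n. f (p n) (q n) c)"
      using p(1) q(1) mono[OF _ _ order_refl] by (simp add: increasing_def)
    have eq: "f a b c = lub (range (\<lambda>n. f (p n) (q n) c))"
      using sup[OF p(1) q(1) increasing_const[of c]]
      by (simp add: lub_singleton lub_eqI[OF p(2)] lub_eqI[OF q(2)])
    show "f a b c \<le> endpoint (abs_ihom (\<lambda>l. f (u l) (v l))) c"
      unfolding eq by (rule lub_least[OF i le])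
  qed
qed

lemma curry:
  "\<exists>\<alpha>. cu_morphism \<alpha> \<and> (\<forall>a b c. endpoint (\<alpha> (a \<otimes> b)) c = f a b c)"
  using tensor_lift[OF cu_bimorphism_ihom_of] endpoint_ihom_of by metis

text \<open>A detour through the internal hom: after currying,
  \<open>endpoint (\<alpha> z) c\<close> is a bimorphism in \<open>z\<close> and \<open>c\<close>,
  so the universal property applies to it.\<close>

lemma lift:
  "\<exists>h. cu_morphism h \<and> (\<forall>a b c. h ((a \<otimes> b) \<otimes> c) = f a b c)"
proof -
  obtain \<alpha> where \<alpha>: "cu_morphism \<alpha>" "\<And>a b c. endpoint (\<alpha> (a \<otimes> b)) c = f a b c"
    using curry by blast
  have "cu_bimorphism (\<lambda>z c. endpoint (\<alpha> z) (id c))"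
    by (rule cu_bimorphism_comp[OF cu_bimorphism_endpoint \<alpha>(1) cu_morphism_id])
  from tensor_lift[OF this] show ?thesis using \<alpha>(2) by (metis id_apply)
qed

end

subsection \<open>Morphisms on tensor products\<close>

lemma tensor_lift_cu: "cu_bimorphism f \<Longrightarrow> cu_morphism (tensor_lift f)"
  and tensor_lift_elem: "cu_bimorphism f \<Longrightarrow> tensor_lift f (a \<otimes> b) = f a b"
  using tensor_lift[of f] by simp_all

lemma tensor_map_cu: "cu_morphism f \<Longrightarrow> cu_morphism g \<Longrightarrow> cu_morphism (tensor_map f g)"
  and tensor_map_elem:
    "cu_morphism f \<Longrightarrow> cu_morphism g \<Longrightarrow> tensor_map f g (a \<otimes> b) = f a \<otimes> g b"
  unfolding tensor_map_def
  by (simp_all add: tensor_lift_cu tensor_lift_elem cu_bimorphism_comp[OF cu_bimorphism_tensor_of])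

lemma tensor_flip_cu: "cu_morphism tensor_flip"
  and tensor_flip_elem: "tensor_flip (a \<otimes> b) = b \<otimes> a"
  unfolding tensor_flip_def
  by (simp_all add: tensor_lift_cu tensor_lift_elem cu_bimorphism_flip[OF cu_bimorphism_tensor_of])

text \<open>Fixing a factor leaves a generalized morphism, and \<open>tensor_morphism_eq\<close> is
  stated for those. Equality can thus be checked one factor at a time.\<close>

lemma gen_cu_morphism_tensor_of:
  assumes "gen_cu_morphism f"
  shows "gen_cu_morphism (\<lambda>a. f (a \<otimes> b))" "gen_cu_morphism (\<lambda>b. f (a \<otimes> b))"
  by (rule gen_cu_morphism_comp[OF assms gen_cu_morphism_bimorphism(2)[OF cu_bimorphism_tensor_of]],
      rule gen_cu_morphism_comp[OF assms gen_cu_morphism_bimorphism(1)[OF cu_bimorphism_tensor_of]])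

lemma tensor_assoc_morphism_eq:
  assumes f: "gen_cu_morphism f" and g: "gen_cu_morphism g"
    and eq: "\<And>a b c. f ((a \<otimes> b) \<otimes> c) = g ((a \<otimes> b) \<otimes> c)"
  shows "f x = g x"
proof (rule tensor_morphism_eq[OF f g])
  show "f (z \<otimes> c) = g (z \<otimes> c)" for z c
    by (rule tensor_morphism_eq[OF gen_cu_morphism_tensor_of(1)[OF f] gen_cu_morphism_tensor_of(1)[OF g]])
      (rule eq)
qed

lemma tensor_assoc_inv_morphism_eq:
  assumes f: "gen_cu_morphism f" and g: "gen_cu_morphism g"
    and eq: "\<And>a b c. f (a \<otimes> (b \<otimes> c)) = g (a \<otimes> (b \<otimes> c))"
  shows "f x = g x"
proof (rule tensor_morphism_eq[OF f g])
  show "f (a \<otimes> z) = g (a \<otimes> z)" for z a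
    by (rule tensor_morphism_eq[OF gen_cu_morphism_tensor_of(2)[OF f] gen_cu_morphism_tensor_of(2)[OF g]])
      (rule eq)
qed

lemma tensor4_morphism_eq:
  assumes f: "gen_cu_morphism f" and g: "gen_cu_morphism g"
    and eq: "\<And>a b c d. f ((a \<otimes> b) \<otimes> (c \<otimes> d)) = g ((a \<otimes> b) \<otimes> (c \<otimes> d))"
  shows "f x = g x"
proof (rule tensor_assoc_morphism_eq[OF f g])
  show "f ((a \<otimes> b) \<otimes> z) = g ((a \<otimes> b) \<otimes> z)" for a b z
    by (rule tensor_morphism_eq[OF gen_cu_morphism_tensor_of(2)[OF f] gen_cu_morphism_tensor_of(2)[OF g]])
      (rule eq)
qed

section \<open>Associativity isomorphisms and the exchange of the middle factors\<close>

lemma tensor_assoc_cu: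
    "cu_morphism (tensor_assoc :: ('a::cu_semigroup \<otimes> 'b::cu_semigroup) \<otimes> 'c::cu_semigroup \<Rightarrow> _)"
  and tensor_assoc_elem: "tensor_assoc ((a \<otimes> b) \<otimes> c) = a \<otimes> (b \<otimes> c)"
  for a :: "'a::cu_semigroup" and b :: "'b::cu_semigroup" and c :: "'c::cu_semigroup"
proof -
  obtain h :: "('a \<otimes> 'b) \<otimes> 'c \<Rightarrow> 'a \<otimes> ('b \<otimes> 'c)"
    where h: "cu_morphism h \<and> (\<forall>a b c. h ((a \<otimes> b) \<otimes> c) = a \<otimes> (b \<otimes> c))"
    using cu_trimorphism.lift[OF cu_trimorphism_right[OF cu_bimorphism_tensor_of cu_bimorphism_tensor_of]]
    by blast
  have "tensor_assoc = h"
    unfolding tensor_assoc_def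
  proof (rule the_equality[where P = "\<lambda>h. cu_morphism h \<and> (\<forall>a b c. h ((a \<otimes> b) \<otimes> c) = a \<otimes> (b \<otimes> c))", OF h])
    fix k :: "('a \<otimes> 'b) \<otimes> 'c \<Rightarrow> 'a \<otimes> ('b \<otimes> 'c)"
    assume k: "cu_morphism k \<and> (\<forall>a b c. k ((a \<otimes> b) \<otimes> c) = a \<otimes> (b \<otimes> c))"
    show "k = h" by (rule ext, rule tensor_assoc_morphism_eq) (simp_all add: h k cu_morphism_gen)
  qed
  with h show "cu_morphism (tensor_assoc :: ('a \<otimes> 'b) \<otimes> 'c \<Rightarrow> _)"
    "tensor_assoc ((a \<otimes> b) \<otimes> c) = a \<otimes> (b \<otimes> c)"
    by simp_all
qed

lemma tensor_assoc_inv_cu: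
    "cu_morphism (tensor_assoc_inv :: 'a::cu_semigroup \<otimes> ('b::cu_semigroup \<otimes> 'c::cu_semigroup) \<Rightarrow> _)"
  and tensor_assoc_inv_elem: "tensor_assoc_inv (a \<otimes> (b \<otimes> c)) = (a \<otimes> b) \<otimes> c"
  for a :: "'a::cu_semigroup" and b :: "'b::cu_semigroup" and c :: "'c::cu_semigroup"
proof -
  \<comment> \<open>\<open>lift\<close> wants the tensor product of two variables on the left, so
    \<open>a\<close> is moved to the end; the flip then restores the order.\<close>
  obtain h' :: "('b \<otimes> 'c) \<otimes> 'a \<Rightarrow> ('a \<otimes> 'b) \<otimes> 'c"
    where h': "cu_morphism h'" "\<forall>b c a. h' ((b \<otimes> c) \<otimes> a) = (a \<otimes> b) \<otimes> c"
    using cu_trimorphism.lift[OF cu_trimorphism_rotate[OF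
        cu_trimorphism_left[OF cu_bimorphism_tensor_of cu_bimorphism_tensor_of]]]
    by blast
  define h where "h = h' \<circ> tensor_flip"
  have h: "cu_morphism h \<and> (\<forall>a b c. h (a \<otimes> (b \<otimes> c)) = (a \<otimes> b) \<otimes> c)"
    using h' by (simp add: h_def cu_morphism_comp tensor_flip_cu tensor_flip_elem)
  have "tensor_assoc_inv = h"
    unfolding tensor_assoc_inv_def
  proof (rule the_equality[where P = "\<lambda>h. cu_morphism h \<and> (\<forall>a b c. h (a \<otimes> (b \<otimes> c)) = (a \<otimes> b) \<otimes> c)", OF h])
    fix k :: "'a \<otimes> ('b \<otimes> 'c) \<Rightarrow> ('a \<otimes> 'b) \<otimes> 'c"
    assume k: "cu_morphism k \<and> (\<forall>a b c. k (a \<otimes> (b \<otimes> c)) = (a \<otimes> b) \<otimes> c)"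
    show "k = h" by (rule ext, rule tensor_assoc_inv_morphism_eq) (simp_all add: h k cu_morphism_gen)
  qed
  with h show "cu_morphism (tensor_assoc_inv :: 'a \<otimes> ('b \<otimes> 'c) \<Rightarrow> _)"
    "tensor_assoc_inv (a \<otimes> (b \<otimes> c)) = (a \<otimes> b) \<otimes> c"
    by simp_all
qed

lemmas tensor_cu =
  cu_morphism_comp cu_morphism_id tensor_map_cu tensor_flip_cu tensor_assoc_cu tensor_assoc_inv_cu

lemmas tensor_elem =
  tensor_map_elem tensor_flip_elem tensor_assoc_elem tensor_assoc_inv_elem

lemma middle_flip_cu: "cu_morphism middle_flip"
  unfolding middle_flip_def by (intro tensor_cu)

lemma middle_flip_elem: "middle_flip ((a \<otimes> b) \<otimes> (c \<otimes> d)) = (a \<otimes> c) \<otimes> (b \<otimes> d)"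
  by (simp add: middle_flip_def tensor_cu tensor_elem)

subsection \<open>Morphisms into the internal hom\<close>

text \<open>
  The endpoint map is not injective, but a Cu-morphism into the internal hom is determined by its
  endpoints: for \<open>x' \<lless> x'' \<lless> x\<close> a path of \<open>\<alpha> x'\<close> lies below a single member of a path of
  \<open>\<alpha> x''\<close>, hence below the endpoint of \<open>\<beta> x''\<close>, and so below a single member of a path of \<open>\<beta> x\<close>.
\<close>

lemma ihom_morphism_le:
  fixes \<alpha> \<beta> :: "'a::cu_semigroup \<Rightarrow> ('b::cu_semigroup, 'c::cu_semigroup) ihom"
  assumes \<alpha>: "cu_morphism \<alpha>" and \<beta>: "cu_morphism \<beta>"
    and le: "\<And>x b. endpoint (\<alpha> x) b \<le> endpoint (\<beta> x) b"
  shows "\<alpha> x \<le> \<beta> x"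
proof -
  have below: "\<alpha> x' \<le> \<beta> x" if x': "x' \<lless> x" for x'
  proof -
    obtain x'' where x'': "x' \<lless> x''" "x'' \<lless> x" using way_below_interpolate[OF x'] by blast
    obtain f where f: "is_path f" "\<alpha> x' = abs_ihom f" by (rule ihom_cases)
    obtain g where g: "is_path g" "\<alpha> x'' = abs_ihom g" by (rule ihom_cases)
    obtain f' where f': "is_path f'" "\<beta> x'' = abs_ihom f'" by (rule ihom_cases)
    obtain g' where g': "is_path g'" "\<beta> x = abs_ihom g'" by (rule ihom_cases)
    have "abs_ihom f \<lless> abs_ihom g" using cu_morphismD(6)[OF \<alpha> x''(1)] unfolding f(2) g(2) .
    then obtain m where m: "m \<in> IQ" "\<forall>l\<in>IQ. f l \<prec> g m" unfolding ihom_way_below[OF f(1) g(1)] by blast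
    have "abs_ihom f' \<lless> abs_ihom g'" using cu_morphismD(6)[OF \<beta> x''(2)] unfolding f'(2) g'(2) .
    then obtain n where n: "n \<in> IQ" "\<forall>l\<in>IQ. f' l \<prec> g' n" unfolding ihom_way_below[OF f'(1) g'(1)] by blast
    have "g m b \<le> g' n b" for b
    proof -
      have "g m b \<le> endpoint (\<alpha> x'') b" unfolding g(2) by (rule endpoint_upper[OF g(1) m(1)])
      also have "\<dots> \<le> endpoint (\<beta> x'') b" by (rule le)
      also have "\<dots> \<le> g' n b"
        unfolding f'(2)
        by (rule endpoint_least[OF f'(1)])
          (rule cu_prec_le[OF bspec[OF n(2)] pathD(1)[OF f'(1)] pathD(1)[OF g'(1) n(1)]])
      finally show ?thesis .
    qed
    then have "\<forall>l\<in>IQ. f l \<prec> g' n" using m(2) cu_prec_le_trans by blast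
    then show ?thesis
      unfolding f(2) g'(2) ihom_le[OF f(1) g'(1)] path_le_def using n(1) by blast
  qed
  obtain s where s: "increasing s" "is_lub (range s) x" "\<And>n. s n \<lless> x" using O2_seq[of x] by blast
  show ?thesis
    \<comment> \<open>The first unfolding writes \<open>x\<close> as \<open>lub (range s)\<close> on
      both sides; the second restores it under \<beta>.\<close>
    unfolding lub_eqI[OF s(2), symmetric] cu_morphismD(5)[OF \<alpha> s(1)]
    unfolding lub_eqI[OF s(2)]
    by (rule lub_least[OF cu_morphismD(4)[OF \<alpha> s(1)] below[OF s(3)]])
qed

lemma ihom_morphism_eq:
  assumes "cu_morphism \<alpha>" "cu_morphism \<beta>" "\<And>x b. endpoint (\<alpha> x) b = endpoint (\<beta> x) b"
  shows "\<alpha> = \<beta>"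
  by (intro ext antisym ihom_morphism_le assms) (simp_all add: assms(3))

section \<open>Uncurrying, evaluation and the endpoints of the two products\<close>

lemma ihom_uncurry_cu: "cu_morphism \<alpha> \<Longrightarrow> cu_morphism (ihom_uncurry \<alpha>)"
  and ihom_uncurry_elem: "cu_morphism \<alpha> \<Longrightarrow> ihom_uncurry \<alpha> (a \<otimes> b) = endpoint (\<alpha> a) b"
  unfolding ihom_uncurry_def
  by (simp_all add: tensor_lift_cu tensor_lift_elem
      cu_bimorphism_comp[OF cu_bimorphism_endpoint _ cu_morphism_id, unfolded id_apply])

lemma eval_map_cu: "cu_morphism eval_map"
  and eval_map_elem: "eval_map (x \<otimes> a) = endpoint x a"
  unfolding eval_map_def by (simp_all add: ihom_uncurry_cu ihom_uncurry_elem cu_morphism_id)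

text \<open>On elementary tensors \<beta> is a trimorphism, so \<open>curry\<close> supplies a
  preimage under \<open>ihom_uncurry\<close>. It is unique by \<open>ihom_morphism_eq\<close>, which
  settles the definite description.\<close>

lemma ihom_curry:
  fixes \<beta> :: "('a::cu_semigroup \<otimes> 'b::cu_semigroup) \<otimes> 'c::cu_semigroup \<Rightarrow> 'd::cu_semigroup"
  assumes \<beta>: "cu_morphism \<beta>"
  shows "cu_morphism (ihom_curry \<beta>)" "endpoint (ihom_curry \<beta> z) c = \<beta> (z \<otimes> c)"
proof -
  obtain \<alpha> where \<alpha>: "cu_morphism \<alpha>" "\<And>a b c. endpoint (\<alpha> (a \<otimes> b)) c = \<beta> ((a \<otimes> b) \<otimes> c)"
    using cu_trimorphism.curry[OF cu_trimorphism_left[OF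
          cu_morphism_bimorphism[OF \<beta> cu_bimorphism_tensor_of] cu_bimorphism_tensor_of]]
    by blast
  have un: "ihom_uncurry \<alpha> = \<beta>"
    by (rule ext, rule tensor_assoc_morphism_eq)
      (simp_all add: \<alpha> \<beta> cu_morphism_gen ihom_uncurry_cu ihom_uncurry_elem)
  have "ihom_curry \<beta> = \<alpha>"
    unfolding ihom_curry_def
  proof (rule the_equality)
    fix \<alpha>' assume \<alpha>': "cu_morphism \<alpha>' \<and> ihom_uncurry \<alpha>' = \<beta>"
    then have "endpoint (\<alpha>' x) b = endpoint (\<alpha> x) b" for x b
      using ihom_uncurry_elem[of \<alpha>' x b] ihom_uncurry_elem[OF \<alpha>(1), of x b] un by simp
    then show "\<alpha>' = \<alpha>" using \<alpha>' \<alpha>(1) by (intro ihom_morphism_eq) simp_all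
  qed (simp add: \<alpha>(1) un)
  then show "cu_morphism (ihom_curry \<beta>)" "endpoint (ihom_curry \<beta> z) c = \<beta> (z \<otimes> c)"
    using \<alpha>(1) ihom_uncurry_elem[OF \<alpha>(1), of z c] un by simp_all
qed

lemma comp_map_cu: "cu_morphism comp_map"
  unfolding comp_map_def by (intro ihom_curry(1) tensor_cu eval_map_cu)

lemma endpoint_comp_product: "endpoint (y \<odot> x) a = endpoint y (endpoint x a)"
  unfolding comp_product_def comp_map_def
  by (subst ihom_curry(2)) (simp_all add: tensor_cu tensor_elem eval_map_cu eval_map_elem)

lemma ext_map_cu: "cu_morphism ext_map"
  unfolding ext_map_def by (intro ihom_curry(1) tensor_cu eval_map_cu middle_flip_cu)

text \<open>Elementary tensors suffice: an endpoint is a generalized morphism and hence determined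
  by its values on them.\<close>

lemma endpoint_ext_product: "endpoint (x \<boxtimes> y) (a \<otimes> b) = endpoint x a \<otimes> endpoint y b"
  unfolding ext_product_def ext_map_def
  by (subst ihom_curry(2))
    (simp_all add: tensor_cu tensor_elem eval_map_cu eval_map_elem middle_flip_cu middle_flip_elem)

theorem proposition3p21:
  fixes x\<^sub>1 :: "('s1::cu_semigroup, 't1::cu_semigroup) ihom"
    and x\<^sub>2 :: "('s2::cu_semigroup, 't2::cu_semigroup) ihom"
    and y\<^sub>1 :: "('t1, 'p1::cu_semigroup) ihom"
    and y\<^sub>2 :: "('t2, 'p2::cu_semigroup) ihom"
  shows "(y\<^sub>2 \<boxtimes> y\<^sub>1) \<odot> (x\<^sub>2 \<boxtimes> x\<^sub>1) = (y\<^sub>2 \<odot> x\<^sub>2) \<boxtimes> (y\<^sub>1 \<odot> x\<^sub>1)"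
proof -
  \<comment> \<open>The four elements are made variable because equal endpoints at fixed elements
    would not give equality in the internal hom.\<close>
  define L :: "(('t2, 'p2) ihom \<otimes> ('t1, 'p1) ihom) \<otimes> (('s2, 't2) ihom \<otimes> ('s1, 't1) ihom)
      \<Rightarrow> ('s2 \<otimes> 's1, 'p2 \<otimes> 'p1) ihom"
    where "L = comp_map \<circ> tensor_map ext_map ext_map"
  define R :: "(('t2, 'p2) ihom \<otimes> ('t1, 'p1) ihom) \<otimes> (('s2, 't2) ihom \<otimes> ('s1, 't1) ihom)
      \<Rightarrow> ('s2 \<otimes> 's1, 'p2 \<otimes> 'p1) ihom"
    where "R = ext_map \<circ> tensor_map comp_map comp_map \<circ> middle_flip"
  have L: "cu_morphism L" and R: "cu_morphism R"
    unfolding L_def R_def by (intro tensor_cu comp_map_cu ext_map_cu middle_flip_cu)+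
  have L_elem: "L ((y \<otimes> y') \<otimes> (x \<otimes> x')) = (y \<boxtimes> y') \<odot> (x \<boxtimes> x')"
    and R_elem: "R ((y \<otimes> y') \<otimes> (x \<otimes> x')) = (y \<odot> x) \<boxtimes> (y' \<odot> x')" for y y' x x'
    by (simp_all add: L_def R_def comp_product_def ext_product_def middle_flip_elem tensor_elem
        comp_map_cu ext_map_cu)
  have "L = R"
  proof (rule ihom_morphism_eq[OF L R])
    fix z v
    have gen: "gen_cu_morphism (\<lambda>z. endpoint (\<alpha> z) v)" if "cu_morphism \<alpha>"
      for \<alpha> :: "'x::cu_semigroup \<Rightarrow> ('s2 \<otimes> 's1, 'p2 \<otimes> 'p1) ihom" and v
      by (rule gen_cu_morphism_comp[OF gen_cu_morphism_bimorphism(2)[OF cu_bimorphism_endpoint]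
            cu_morphism_gen[OF that]])
    show "endpoint (L z) v = endpoint (R z) v"
    \<comment> \<open>First \<open>v\<close> is reduced to an elementary tensor for arbitrary
      \<open>z\<close>, then \<open>z\<close> to a fourfold one, where \<open>gen\<close> supplies
      the dependence on \<open>z\<close>.\<close>
    proof (rule tensor_morphism_eq[OF gen_cu_morphism_endpoint gen_cu_morphism_endpoint])
      fix a b
      show "endpoint (L z) (a \<otimes> b) = endpoint (R z) (a \<otimes> b)"
        by (rule tensor4_morphism_eq[OF gen[OF L] gen[OF R]])
          (simp add: L_elem R_elem endpoint_comp_product endpoint_ext_product)
    qed
  qed
  then show ?thesis using L_elem[of y\<^sub>2 y\<^sub>1 x\<^sub>2 x\<^sub>1] R_elem[of y\<^sub>2 y\<^sub>1 x\<^sub>2 x\<^sub>1] by simp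
qed

end
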